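(* Let $k$ be a commutative ring with unit and let $G$ be a (discrete) group, finite or infinite. There is a direct sum splitting of cochain complexes $$\mathrm{Hom}_k(k[G]^{\otimes *},k[G])\;\simeq\;AP(k[G]^{\otimes *})\oplus NP(k[G]^{\otimes *}),$$ where in dimension zero the cochains in $AP(k[G]^{\otimes *})$ are taken to be strictly autopoietic.
   Context: $k[G]$ is the group ring and $e\in G$ is the identity. All tensor products are over $k$, with $k[G]^{\otimes 0}=k$. The Hochschild differential is, for $f\in \mathrm{Hom}_k(k[G]^{\otimes n},k[G])$, $$(\delta f)(g_1\otimes\cdots\otimes g_{n+1})=g_1f(g_2\otimes\cdots\otimes g_{n+1})+\sum_{i=1}^n(-1)^if(g_1\otimes\cdots\otimes g_ig_{i+1}\otimes\cdots\otimes g_{n+1})+(-1)^{n+1}f(g_1\otimes\cdots\otimes g_n)g_{n+1},$$ and for $n=0$, $(\delta f)(g_1)=g_1f(1)-f(1)g_1$. Autopoietic cochains: for $n\ge1$, $f\in \mathrm{Hom}_k(k[G]^{\otimes n},k[G])$ is autopoietic if for all $(g_1,\dots,g_n)\in G^n$ there is $\lambda_{g_1,\dots,g_n}\in k$ with $f(g_1\otimes\cdots\otimes g_n)=\lambda_{g_1,\dots,g_n}\,(g_1g_2\cdots g_n)$; for $n=0$, $f$ is strictly autopoietic if $f(1)=\lambda e$ for some $\lambda\in k$. $AP(k[G]^{\otimes n})$ is the submodule of these cochains (strictly autopoietic for $n=0$). Non-autopoietic cochains: for $g\in G$ let $\pi_g:k[G]\to k$ send $\sum_{h\in G}c_hh$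 to $c_g$. For $n\ge 1$, $f\in \mathrm{Hom}_k(k[G]^{\otimes n},k[G])$ is non-autopoietic if for all $(g_1,\dots,g_n)\in G^n$, $\pi_h(f(g_1\otimes\cdots\otimes g_n))=0$ where $h=g_1g_2\cdots g_n$; for $n=0$, $f$ is non-autopoietic if the coefficient of $e$ in $f(1)$ is zero. $NP(k[G]^{\otimes n})$ is the submodule of non-autopoietic cochains. Both $AP(k[G]^{\otimes *})$ and $NP(k[G]^{\otimes *})$ carry the differential $\delta$. *)

theory Defs
  imports "HOL-Algebra.Module" "HOL-Algebra.AbelCoset"
begin

text \<open>
  Modules are records of type \<open>('r, 'm) module\<close>. This record type extends rings, so it has
  fields \<open>mult\<close> and \<open>one\<close>; for objects that are merely modules these are left \<open>undefined\<close>
  and are never used.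
\<close>

section \<open>Modules\<close>

text \<open>
  The free module on a set: finitely supported functions, equal to zero outside \<open>S\<close>.
\<close>

definition free_module :: "('r, 'x) ring_scheme \<Rightarrow> 's set \<Rightarrow> ('r, 's \<Rightarrow> 'r) module" where
  "free_module R S =
    \<lparr> carrier = {c. (\<forall>s. c s \<in> carrier R) \<and> (\<forall>s. s \<notin> S \<longrightarrow> c s = \<zero>\<^bsub>R\<^esub>) \<and> finite {s. c s \<noteq> \<zero>\<^bsub>R\<^esub>}},
      mult = undefined,
      one = undefined,
      zero = (\<lambda>s. \<zero>\<^bsub>R\<^esub>),
      add = (\<lambda>a b s. a s \<oplus>\<^bsub>R\<^esub> b s),
      smult = (\<lambda>r a s. r \<otimes>\<^bsub>R\<^esub> a s) \<rparr>"

definition basis_elem :: "('r, 'x) ring_scheme \<Rightarrow> 's \<Rightarrow> 's \<Rightarrow> 'r" where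
  "basis_elem R s = (\<lambda>t. if t = s then \<one>\<^bsub>R\<^esub> else \<zero>\<^bsub>R\<^esub>)"

definition mod_hom ::
  "('r, 'x) ring_scheme \<Rightarrow> ('r, 'm) module \<Rightarrow> ('r, 'n) module \<Rightarrow> ('m \<Rightarrow> 'n) set" where
  "mod_hom R M N = {f \<in> carrier M \<rightarrow> carrier N.
     (\<forall>x\<in>carrier M. \<forall>y\<in>carrier M. f (x \<oplus>\<^bsub>M\<^esub> y) = f x \<oplus>\<^bsub>N\<^esub> f y) \<and>
     (\<forall>r\<in>carrier R. \<forall>x\<in>carrier M. f (r \<odot>\<^bsub>M\<^esub> x) = r \<odot>\<^bsub>N\<^esub> f x)}"

text \<open>
  In the module \<open>Hom(M, N)\<close> a homomorphism is represented by its unique extensional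
  representative (\<open>undefined\<close> outside \<open>carrier M\<close>), so that equality of elements is equality of
  homomorphisms.
\<close>

definition Hom_module ::
  "('r, 'x) ring_scheme \<Rightarrow> ('r, 'm) module \<Rightarrow> ('r, 'n) module \<Rightarrow> ('r, 'm \<Rightarrow> 'n) module" where
  "Hom_module R M N =
    \<lparr> carrier = mod_hom R M N \<inter> extensional (carrier M),
      mult = undefined,
      one = undefined,
      zero = (\<lambda>x\<in>carrier M. \<zero>\<^bsub>N\<^esub>),
      add = (\<lambda>f g. \<lambda>x\<in>carrier M. f x \<oplus>\<^bsub>N\<^esub> g x),
      smult = (\<lambda>r f. \<lambda>x\<in>carrier M. r \<odot>\<^bsub>N\<^esub> f x) \<rparr>"

definition submodule_span ::
  "('r, 'x) ring_scheme \<Rightarrow> ('r, 'm) module \<Rightarrow> 'm set \<Rightarrow> 'm set" where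
  "submodule_span R M A = \<Inter>{N. submodule N R M \<and> A \<subseteq> N}"

definition quotient_module :: "('r, 'm) module \<Rightarrow> 'm set \<Rightarrow> ('r, 'm set) module" where
  "quotient_module M N =
    \<lparr> carrier = a_rcosets\<^bsub>M\<^esub> N,
      mult = undefined,
      one = undefined,
      zero = N,
      add = (\<lambda>X Y. X <+>\<^bsub>M\<^esub> Y),
      smult = (\<lambda>r X. \<Union>x\<in>X. N +>\<^bsub>M\<^esub> (r \<odot>\<^bsub>M\<^esub> x)) \<rparr>"

definition direct_sum_module ::
  "('r, 'm) module \<Rightarrow> ('r, 'n) module \<Rightarrow> ('r, 'm \<times> 'n) module" where
  "direct_sum_module M N =
    \<lparr> carrier = carrier M \<times> carrier N,
      mult = undefined,
      one = undefined,
      zero = (\<zero>\<^bsub>M\<^esub>, \<zero>\<^bsub>N\<^esub>),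
      add = (\<lambda>(x, y) (x', y'). (x \<oplus>\<^bsub>M\<^esub> x', y \<oplus>\<^bsub>N\<^esub> y')),
      smult = (\<lambda>r (x, y). (r \<odot>\<^bsub>M\<^esub> x, r \<odot>\<^bsub>N\<^esub> y)) \<rparr>"


section \<open>Tensor powers\<close>

text \<open>
  The tensor power \<open>M\<^sup>\<otimes>\<^sup>n\<close> over \<open>R\<close> is the free module on \<open>n\<close>-tuples of elements of \<open>M\<close>, modulo the
  submodule generated by the multilinearity relations. For \<open>n = 0\<close> there are no relations and
  the only tuple is \<open>[]\<close>, so the result is a copy of \<open>R\<close>, with \<open>pure_tensor R M []\<close> as its unit.
\<close>

definition tuples :: "'s set \<Rightarrow> nat \<Rightarrow> 's list set" where
  "tuples S n = {xs. length xs = n \<and> set xs \<subseteq> S}"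

definition free_on_tuples ::
  "('r, 'x) ring_scheme \<Rightarrow> ('r, 'm) module \<Rightarrow> nat \<Rightarrow> ('r, 'm list \<Rightarrow> 'r) module" where
  "free_on_tuples R M n = free_module R (tuples (carrier M) n)"

definition multilinear_relations ::
  "('r, 'x) ring_scheme \<Rightarrow> ('r, 'm) module \<Rightarrow> nat \<Rightarrow> ('m list \<Rightarrow> 'r) set" where
  "multilinear_relations R M n =
    (let F = free_on_tuples R M n; e = basis_elem R in
      {e (us @ [x \<oplus>\<^bsub>M\<^esub> y] @ vs) \<ominus>\<^bsub>F\<^esub> (e (us @ [x] @ vs) \<oplus>\<^bsub>F\<^esub> e (us @ [y] @ vs)) | us vs x y.
         set us \<union> set vs \<union> {x, y} \<subseteq> carrier M \<and> Suc (length us + length vs) = n} \<union>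
      {e (us @ [r \<odot>\<^bsub>M\<^esub> x] @ vs) \<ominus>\<^bsub>F\<^esub> (r \<odot>\<^bsub>F\<^esub> e (us @ [x] @ vs)) | us vs r x.
         set us \<union> set vs \<union> {x} \<subseteq> carrier M \<and> r \<in> carrier R \<and> Suc (length us + length vs) = n})"

definition relation_submodule ::
  "('r, 'x) ring_scheme \<Rightarrow> ('r, 'm) module \<Rightarrow> nat \<Rightarrow> ('m list \<Rightarrow> 'r) set" where
  "relation_submodule R M n =
    submodule_span R (free_on_tuples R M n) (multilinear_relations R M n)"

definition tensor_power ::
  "('r, 'x) ring_scheme \<Rightarrow> ('r, 'm) module \<Rightarrow> nat \<Rightarrow> ('r, ('m list \<Rightarrow> 'r) set) module" where
  "tensor_power R M n = quotient_module (free_on_tuples R M n) (relation_submodule R M n)"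

definition pure_tensor ::
  "('r, 'x) ring_scheme \<Rightarrow> ('r, 'm) module \<Rightarrow> 'm list \<Rightarrow> ('m list \<Rightarrow> 'r) set" where
  "pure_tensor R M xs =
    relation_submodule R M (length xs) +>\<^bsub>free_on_tuples R M (length xs)\<^esub> basis_elem R xs"


section \<open>Cochain complexes\<close>

record ('r, 'm) cochain_cpx =
  cochains :: "nat \<Rightarrow> ('r, 'm) module"
  differential :: "nat \<Rightarrow> 'm \<Rightarrow> 'm"

definition is_cochain_complex :: "('r, 'x) ring_scheme \<Rightarrow> ('r, 'm) cochain_cpx \<Rightarrow> bool" where
  "is_cochain_complex R C \<longleftrightarrow>
    (\<forall>n. module R (cochains C n)) \<and>
    (\<forall>n. differential C n \<in> mod_hom R (cochains C n) (cochains C (Suc n))) \<and>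
    (\<forall>n. \<forall>x\<in>carrier (cochains C n).
       differential C (Suc n) (differential C n x) = \<zero>\<^bsub>cochains C (Suc (Suc n))\<^esub>)"

definition is_cochain_iso ::
  "('r, 'x) ring_scheme \<Rightarrow> ('r, 'm) cochain_cpx \<Rightarrow> ('r, 'n) cochain_cpx \<Rightarrow> (nat \<Rightarrow> 'm \<Rightarrow> 'n) \<Rightarrow> bool"
where
  "is_cochain_iso R C D \<phi> \<longleftrightarrow>
    (\<forall>n. \<phi> n \<in> mod_hom R (cochains C n) (cochains D n)) \<and>
    (\<forall>n. bij_betw (\<phi> n) (carrier (cochains C n)) (carrier (cochains D n))) \<and>
    (\<forall>n. \<forall>x\<in>carrier (cochains C n).
       \<phi> (Suc n) (differential C n x) = differential D n (\<phi> n x))"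

definition direct_sum_complex ::
  "('r, 'm) cochain_cpx \<Rightarrow> ('r, 'n) cochain_cpx \<Rightarrow> ('r, 'm \<times> 'n) cochain_cpx" where
  "direct_sum_complex C D =
    \<lparr> cochains = (\<lambda>n. direct_sum_module (cochains C n) (cochains D n)),
      differential = (\<lambda>n (x, y). (differential C n x, differential D n y)) \<rparr>"


section \<open>The group ring and its Hochschild cochains\<close>

definition group_ring ::
  "('r, 'x) ring_scheme \<Rightarrow> ('g, 'y) monoid_scheme \<Rightarrow> ('r, 'g \<Rightarrow> 'r) module" where
  "group_ring R G = (free_module R (carrier G))
    \<lparr> mult := (\<lambda>a b g. finsum R (\<lambda>(h, h'). a h \<otimes>\<^bsub>R\<^esub> b h')
                 {(h, h'). a h \<noteq> \<zero>\<^bsub>R\<^esub> \<and> b h' \<noteq> \<zero>\<^bsub>R\<^esub> \<and> h \<otimes>\<^bsub>G\<^esub> h' = g}),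
      one := basis_elem R \<one>\<^bsub>G\<^esub> \<rparr>"

type_synonym ('r, 'g) hochschild_cochain = "(('g \<Rightarrow> 'r) list \<Rightarrow> 'r) set \<Rightarrow> 'g \<Rightarrow> 'r"

definition hochschild_module ::
  "('r, 'x) ring_scheme \<Rightarrow> ('g, 'y) monoid_scheme \<Rightarrow> nat \<Rightarrow> ('r, ('r, 'g) hochschild_cochain) module"
where
  "hochschild_module R G n =
    Hom_module R (tensor_power R (group_ring R G) n) (group_ring R G)"

text \<open>The element \<open>g\<^sub>1 \<otimes> \<dots> \<otimes> g\<^sub>n\<close> of \<open>k[G]\<^sup>\<otimes>\<^sup>n\<close>; for \<open>n = 0\<close> it is \<open>1 \<in> k\<close>.\<close>

definition group_tensor ::
  "('r, 'x) ring_scheme \<Rightarrow> ('g, 'y) monoid_scheme \<Rightarrow> 'g list \<Rightarrow> (('g \<Rightarrow> 'r) list \<Rightarrow> 'r) set" where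
  "group_tensor R G gs = pure_tensor R (group_ring R G) (map (basis_elem R) gs)"

text \<open>
  A cochain may be prescribed freely on the tensors \<open>g\<^sub>1 \<otimes> \<dots> \<otimes> g\<^sub>n\<close>, as they form a basis of
  \<open>k[G]\<^sup>\<otimes>\<^sup>n\<close>; this is what makes the description below well defined.
\<close>

definition cochain_with_values ::
  "('r, 'x) ring_scheme \<Rightarrow> ('g, 'y) monoid_scheme \<Rightarrow> nat \<Rightarrow> ('g list \<Rightarrow> 'g \<Rightarrow> 'r)
    \<Rightarrow> ('r, 'g) hochschild_cochain" where
  "cochain_with_values R G n v =
    (THE f. f \<in> carrier (hochschild_module R G n) \<and>
       (\<forall>gs\<in>tuples (carrier G) n. f (group_tensor R G gs) = v gs))"

text \<open>
  \<open>(g\<^sub>1, \<dots>, g\<^sub>i g\<^sub>i\<^sub>+\<^sub>1, \<dots>, g\<^sub>n\<^sub>+\<^sub>1)\<close>, where \<open>g\<^sub>i\<close> is the list entry of index \<open>i - 1\<close>.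
\<close>

definition merge_at :: "('g, 'y) monoid_scheme \<Rightarrow> nat \<Rightarrow> 'g list \<Rightarrow> 'g list" where
  "merge_at G i gs = take (i - 1) gs @ [gs ! (i - 1) \<otimes>\<^bsub>G\<^esub> gs ! i] @ drop (i + 1) gs"

definition hochschild_differential ::
  "('r, 'x) ring_scheme \<Rightarrow> ('g, 'y) monoid_scheme \<Rightarrow> nat
    \<Rightarrow> ('r, 'g) hochschild_cochain \<Rightarrow> ('r, 'g) hochschild_cochain" where
  "hochschild_differential R G n f =
    (let K = group_ring R G; sgn = (\<lambda>i::nat. (\<ominus>\<^bsub>R\<^esub> \<one>\<^bsub>R\<^esub>) [^]\<^bsub>R\<^esub> i) in
     cochain_with_values R G (Suc n) (\<lambda>gs.
       (basis_elem R (hd gs) \<otimes>\<^bsub>K\<^esub> f (group_tensor R G (tl gs)))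
       \<oplus>\<^bsub>K\<^esub> (\<Oplus>\<^bsub>K\<^esub>i\<in>{1..n}. sgn i \<odot>\<^bsub>K\<^esub> f (group_tensor R G (merge_at G i gs)))
       \<oplus>\<^bsub>K\<^esub> (sgn (n + 1) \<odot>\<^bsub>K\<^esub> (f (group_tensor R G (butlast gs)) \<otimes>\<^bsub>K\<^esub> basis_elem R (last gs)))))"

definition hochschild_complex ::
  "('r, 'x) ring_scheme \<Rightarrow> ('g, 'y) monoid_scheme \<Rightarrow> ('r, ('r, 'g) hochschild_cochain) cochain_cpx"
where
  "hochschild_complex R G =
    \<lparr> cochains = hochschild_module R G, differential = hochschild_differential R G \<rparr>"


section \<open>Autopoietic and non-autopoietic cochains\<close>

definition group_prod :: "('g, 'y) monoid_scheme \<Rightarrow> 'g list \<Rightarrow> 'g" where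
  "group_prod G gs = foldr (\<lambda>g h. g \<otimes>\<^bsub>G\<^esub> h) gs \<one>\<^bsub>G\<^esub>"

text \<open>
  For \<open>n = 0\<close> the only tuple is \<open>[]\<close>, with product \<open>e\<close>, so that the two conditions below become
  \<open>f(1) = \<lambda>e\<close> (strictly autopoietic) and the vanishing of the coefficient of \<open>e\<close> in \<open>f(1)\<close>.
\<close>

definition autopoietic ::
  "('r, 'x) ring_scheme \<Rightarrow> ('g, 'y) monoid_scheme \<Rightarrow> nat \<Rightarrow> ('r, 'g) hochschild_cochain \<Rightarrow> bool"
where
  "autopoietic R G n f \<longleftrightarrow>
    (\<forall>gs\<in>tuples (carrier G) n. \<exists>l\<in>carrier R.
       f (group_tensor R G gs) = l \<odot>\<^bsub>group_ring R G\<^esub> basis_elem R (group_prod G gs))"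

definition coeff_at :: "'g \<Rightarrow> ('g \<Rightarrow> 'r) \<Rightarrow> 'r" where
  "coeff_at g a = a g"

definition non_autopoietic ::
  "('r, 'x) ring_scheme \<Rightarrow> ('g, 'y) monoid_scheme \<Rightarrow> nat \<Rightarrow> ('r, 'g) hochschild_cochain \<Rightarrow> bool"
where
  "non_autopoietic R G n f \<longleftrightarrow>
    (\<forall>gs\<in>tuples (carrier G) n. coeff_at (group_prod G gs) (f (group_tensor R G gs)) = \<zero>\<^bsub>R\<^esub>)"

definition AP_complex ::
  "('r, 'x) ring_scheme \<Rightarrow> ('g, 'y) monoid_scheme \<Rightarrow> ('r, ('r, 'g) hochschild_cochain) cochain_cpx"
where
  "AP_complex R G =
    \<lparr> cochains = (\<lambda>n. (hochschild_module R G n)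
        \<lparr> carrier := {f \<in> carrier (hochschild_module R G n). autopoietic R G n f} \<rparr>),
      differential = hochschild_differential R G \<rparr>"

definition NP_complex ::
  "('r, 'x) ring_scheme \<Rightarrow> ('g, 'y) monoid_scheme \<Rightarrow> ('r, ('r, 'g) hochschild_cochain) cochain_cpx"
where
  "NP_complex R G =
    \<lparr> cochains = (\<lambda>n. (hochschild_module R G n)
        \<lparr> carrier := {f \<in> carrier (hochschild_module R G n). non_autopoietic R G n f} \<rparr>),
      differential = hochschild_differential R G \<rparr>"

end

theory Submission
  imports Defs
begin

text \<open>
  A cochain is determined by its values on the tensors \<open>g\<^sub>1 \<otimes> \<dots> \<otimes> g\<^sub>n\<close>, and these values may be
  prescribed arbitrarily; both follow from the universal properties of the free module, of the
  quotient module and of the tensor power (\<open>cochain_eq_if_values_eq\<close>, \<open>cochain_with_values\<close>). So a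
  cochain \<open>f\<close> amounts to a scalar function of the coefficients of its values, and it is convenient
  to record the coefficient of \<open>h\<close> in \<open>f(g\<^sub>1 \<otimes> \<dots> \<otimes> g\<^sub>n)\<close> as the value of a function \<open>\<phi>\<close> at the
  tuple \<open>(g\<^sub>0, g\<^sub>1, \<dots>, g\<^sub>n)\<close> with \<open>g\<^sub>0 = h\<^sup>-\<^sup>1\<close>.

  In these coordinates the Hochschild differential is the alternating sum over the faces of the
  cyclic bar construction: \<open>g\<^sub>i\<close> is multiplied with \<open>g\<^sub>i\<^sub>+\<^sub>1\<close>, and in the last face the last entry
  with \<open>g\<^sub>0\<close> (\<open>cyclic_coeff_differential\<close>). Its square vanishes by the simplicial identities
  (\<open>cyclic_face_cyclic_face\<close>) and the usual cancellation in pairs (\<open>finsum_simplicial_cancel\<close>).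

  A cochain is autopoietic if and only if \<open>\<phi>\<close> vanishes where \<open>g\<^sub>0 g\<^sub>1 \<dots> g\<^sub>n \<noteq> e\<close>, and non-autopoietic
  if and only if \<open>\<phi>\<close> vanishes where \<open>g\<^sub>0 g\<^sub>1 \<dots> g\<^sub>n = e\<close>. A face preserves the product of the
  tuple up to conjugation, hence also whether it is trivial (\<open>group_prod_cyclic_face\<close>). So the
  differential preserves both conditions, and splitting \<open>\<phi>\<close> into its restrictions to the two
  complementary sets of tuples gives the direct sum decomposition.
\<close>

section \<open>Module homomorphisms\<close>

lemma mod_homI:
  assumes "\<And>x. x \<in> carrier M \<Longrightarrow> f x \<in> carrier N"
    and "\<And>x y. x \<in> carrier M \<Longrightarrow> y \<in> carrier M \<Longrightarrow> f (x \<oplus>\<^bsub>M\<^esub> y) = f x \<oplus>\<^bsub>N\<^esub> f y"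
    and "\<And>r x. r \<in> carrier R \<Longrightarrow> x \<in> carrier M \<Longrightarrow> f (r \<odot>\<^bsub>M\<^esub> x) = r \<odot>\<^bsub>N\<^esub> f x"
  shows "f \<in> mod_hom R M N"
  using assms by (auto simp: mod_hom_def)

lemma mod_homD:
  assumes "f \<in> mod_hom R M N"
  shows mod_hom_closed: "x \<in> carrier M \<Longrightarrow> f x \<in> carrier N"
    and mod_hom_add: "x \<in> carrier M \<Longrightarrow> y \<in> carrier M \<Longrightarrow> f (x \<oplus>\<^bsub>M\<^esub> y) = f x \<oplus>\<^bsub>N\<^esub> f y"
    and mod_hom_smult: "r \<in> carrier R \<Longrightarrow> x \<in> carrier M \<Longrightarrow> f (r \<odot>\<^bsub>M\<^esub> x) = r \<odot>\<^bsub>N\<^esub> f x"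
  using assms by (auto simp: mod_hom_def)

lemma mod_hom_zero:
  assumes "module R M" "module R N" "f \<in> mod_hom R M N"
  shows "f \<zero>\<^bsub>M\<^esub> = \<zero>\<^bsub>N\<^esub>"
proof -
  interpret M: module R M by fact
  interpret N: module R N by fact
  have "f \<zero>\<^bsub>M\<^esub> = f (\<zero>\<^bsub>R\<^esub> \<odot>\<^bsub>M\<^esub> \<zero>\<^bsub>M\<^esub>)" by simp
  also have "\<dots> = \<zero>\<^bsub>R\<^esub> \<odot>\<^bsub>N\<^esub> f \<zero>\<^bsub>M\<^esub>"
    using mod_hom_smult[OF assms(3)] by blast
  finally show ?thesis using mod_hom_closed[OF assms(3)] by simp
qed

lemma mod_hom_minus:
  assumes "module R M" "module R N" "f \<in> mod_hom R M N" "x \<in> carrier M"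
  shows "f (\<ominus>\<^bsub>M\<^esub> x) = \<ominus>\<^bsub>N\<^esub> f x"
proof -
  interpret M: module R M by fact
  interpret N: module R N by fact
  have "f (\<ominus>\<^bsub>M\<^esub> x) = f ((\<ominus>\<^bsub>R\<^esub> \<one>\<^bsub>R\<^esub>) \<odot>\<^bsub>M\<^esub> x)"
    using assms(4) by (simp add: M.smult_l_minus)
  also have "\<dots> = (\<ominus>\<^bsub>R\<^esub> \<one>\<^bsub>R\<^esub>) \<odot>\<^bsub>N\<^esub> f x"
    using mod_hom_smult[OF assms(3)] assms(4) by simp
  finally show ?thesis
    using mod_hom_closed[OF assms(3,4)] by (simp add: N.smult_l_minus)
qed

lemma mod_hom_comp:
  assumes "f \<in> mod_hom R M N" "g \<in> mod_hom R N P"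
  shows "(\<lambda>x. g (f x)) \<in> mod_hom R M P"
  using assms by (auto simp: mod_hom_def Pi_iff)

lemma Hom_module_simps:
  "carrier (Hom_module R M N) = mod_hom R M N \<inter> extensional (carrier M)"
  "\<zero>\<^bsub>Hom_module R M N\<^esub> = (\<lambda>x\<in>carrier M. \<zero>\<^bsub>N\<^esub>)"
  "f \<oplus>\<^bsub>Hom_module R M N\<^esub> g = (\<lambda>x\<in>carrier M. f x \<oplus>\<^bsub>N\<^esub> g x)"
  "r \<odot>\<^bsub>Hom_module R M N\<^esub> f = (\<lambda>x\<in>carrier M. r \<odot>\<^bsub>N\<^esub> f x)"
  by (simp_all add: Hom_module_def)

text \<open>
  Only closure of \<open>M\<close> under the operations is needed, not the module laws, as these enter only
  through \<open>N\<close>.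
\<close>

lemma module_Hom_module:
  assumes "module R N"
    and M_add: "\<And>x y. x \<in> carrier M \<Longrightarrow> y \<in> carrier M \<Longrightarrow> x \<oplus>\<^bsub>M\<^esub> y \<in> carrier M"
    and M_smult: "\<And>r x. r \<in> carrier R \<Longrightarrow> x \<in> carrier M \<Longrightarrow> r \<odot>\<^bsub>M\<^esub> x \<in> carrier M"
  shows "module R (Hom_module R M N)"
proof -
  interpret N: module R N by fact
  have closed: "f x \<in> carrier N" if "f \<in> carrier (Hom_module R M N)" "x \<in> carrier M" for f x
    using that by (auto simp: Hom_module_simps mod_hom_def)
  have ext: "f = g" if "f \<in> carrier (Hom_module R M N)" "g \<in> carrier (Hom_module R M N)"
      "\<And>x. x \<in> carrier M \<Longrightarrow> f x = g x" for f g
    using that by (auto simp: Hom_module_simps intro: extensionalityI)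
  have add: "f \<oplus>\<^bsub>Hom_module R M N\<^esub> g \<in> carrier (Hom_module R M N)"
    if fg: "f \<in> carrier (Hom_module R M N)" "g \<in> carrier (Hom_module R M N)" for f g
  proof -
    have "f \<in> mod_hom R M N" "g \<in> mod_hom R M N" using fg by (auto simp: Hom_module_simps)
    then show ?thesis unfolding Hom_module_simps
      by (auto intro!: mod_homI simp: M_add M_smult mod_homD N.smult_r_distr N.a_ac)
  qed
  have zero: "\<zero>\<^bsub>Hom_module R M N\<^esub> \<in> carrier (Hom_module R M N)"
    unfolding Hom_module_simps by (auto intro!: mod_homI simp: M_add M_smult)
  have smult: "r \<odot>\<^bsub>Hom_module R M N\<^esub> f \<in> carrier (Hom_module R M N)"
    if r: "r \<in> carrier R" and f: "f \<in> carrier (Hom_module R M N)" for r f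
  proof -
    have "f \<in> mod_hom R M N" using f by (auto simp: Hom_module_simps)
    then show ?thesis unfolding Hom_module_simps using r
      by (auto intro!: mod_homI
          simp: M_add M_smult mod_homD N.smult_r_distr N.smult_assoc1[symmetric] N.m_comm)
  qed
  have "abelian_group (Hom_module R M N)"
  proof (rule abelian_groupI)
    fix f assume f: "f \<in> carrier (Hom_module R M N)"
    let ?g = "(\<ominus>\<^bsub>R\<^esub> \<one>\<^bsub>R\<^esub>) \<odot>\<^bsub>Hom_module R M N\<^esub> f"
    have "?g \<in> carrier (Hom_module R M N)" using smult f by simp
    moreover have "?g \<oplus>\<^bsub>Hom_module R M N\<^esub> f = \<zero>\<^bsub>Hom_module R M N\<^esub>"
      using closed[OF f]
      by (auto simp: Hom_module_simps N.smult_l_minus N.l_neg intro!: restrict_ext)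
    ultimately show "\<exists>g\<in>carrier (Hom_module R M N). g \<oplus>\<^bsub>Hom_module R M N\<^esub> f = \<zero>\<^bsub>Hom_module R M N\<^esub>"
      by blast
  next
    fix f g h
    assume fgh: "f \<in> carrier (Hom_module R M N)" "g \<in> carrier (Hom_module R M N)"
      "h \<in> carrier (Hom_module R M N)"
    show "f \<oplus>\<^bsub>Hom_module R M N\<^esub> g \<oplus>\<^bsub>Hom_module R M N\<^esub> h
        = f \<oplus>\<^bsub>Hom_module R M N\<^esub> (g \<oplus>\<^bsub>Hom_module R M N\<^esub> h)"
      using closed fgh by (auto simp: Hom_module_simps(3) N.a_assoc intro!: restrict_ext)
  next
    fix f g
    assume fg: "f \<in> carrier (Hom_module R M N)" "g \<in> carrier (Hom_module R M N)"
    show "f \<oplus>\<^bsub>Hom_module R M N\<^esub> g = g \<oplus>\<^bsub>Hom_module R M N\<^esub> f"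
      using closed fg by (auto simp: Hom_module_simps(3) N.a_comm intro!: restrict_ext)
  next
    fix f assume f: "f \<in> carrier (Hom_module R M N)"
    show "\<zero>\<^bsub>Hom_module R M N\<^esub> \<oplus>\<^bsub>Hom_module R M N\<^esub> f = f"
      by (rule ext[OF add[OF zero f] f]) (simp add: Hom_module_simps(2,3) closed[OF f])
  qed (rule add zero; assumption?)+
  then show ?thesis
  proof (rule moduleI[OF N.is_cring])
    fix f assume f: "f \<in> carrier (Hom_module R M N)"
    show "\<one>\<^bsub>R\<^esub> \<odot>\<^bsub>Hom_module R M N\<^esub> f = f"
      by (rule ext[OF smult[OF _ f] f]) (simp_all add: Hom_module_simps(4) closed[OF f])
  next
    fix a b f assume "a \<in> carrier R" "b \<in> carrier R" and f: "f \<in> carrier (Hom_module R M N)"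
    then show "(a \<oplus>\<^bsub>R\<^esub> b) \<odot>\<^bsub>Hom_module R M N\<^esub> f
        = a \<odot>\<^bsub>Hom_module R M N\<^esub> f \<oplus>\<^bsub>Hom_module R M N\<^esub> b \<odot>\<^bsub>Hom_module R M N\<^esub> f"
      unfolding Hom_module_simps(3,4) by (intro restrict_ext) (simp add: closed[OF f] N.smult_l_distr)
  next
    fix a f g assume "a \<in> carrier R"
      and f: "f \<in> carrier (Hom_module R M N)" and g: "g \<in> carrier (Hom_module R M N)"
    then show "a \<odot>\<^bsub>Hom_module R M N\<^esub> (f \<oplus>\<^bsub>Hom_module R M N\<^esub> g)
        = a \<odot>\<^bsub>Hom_module R M N\<^esub> f \<oplus>\<^bsub>Hom_module R M N\<^esub> a \<odot>\<^bsub>Hom_module R M N\<^esub> g"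
      unfolding Hom_module_simps(3,4)
      by (intro restrict_ext) (simp add: closed[OF f] closed[OF g] N.smult_r_distr)
  next
    fix a b f assume "a \<in> carrier R" "b \<in> carrier R" and f: "f \<in> carrier (Hom_module R M N)"
    then show "(a \<otimes>\<^bsub>R\<^esub> b) \<odot>\<^bsub>Hom_module R M N\<^esub> f
        = a \<odot>\<^bsub>Hom_module R M N\<^esub> (b \<odot>\<^bsub>Hom_module R M N\<^esub> f)"
      unfolding Hom_module_simps(4) by (intro restrict_ext) (simp add: closed[OF f] N.smult_assoc1)
  qed (rule smult)
qed


section \<open>Free modules\<close>

lemma free_module_simps:
  "carrier (free_module R S) =
    {c. (\<forall>s. c s \<in> carrier R) \<and> (\<forall>s. s \<notin> S \<longrightarrow> c s = \<zero>\<^bsub>R\<^esub>) \<and> finite {s. c s \<noteq> \<zero>\<^bsub>R\<^esub>}}"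
  "\<zero>\<^bsub>free_module R S\<^esub> = (\<lambda>s. \<zero>\<^bsub>R\<^esub>)"
  "a \<oplus>\<^bsub>free_module R S\<^esub> b = (\<lambda>s. a s \<oplus>\<^bsub>R\<^esub> b s)"
  "r \<odot>\<^bsub>free_module R S\<^esub> a = (\<lambda>s. r \<otimes>\<^bsub>R\<^esub> a s)"
  by (simp_all add: free_module_def)

lemma module_free_module:
  assumes "cring R"
  shows "module R (free_module R S)"
proof -
  interpret R: cring R by fact
  have add: "a \<oplus>\<^bsub>free_module R S\<^esub> b \<in> carrier (free_module R S)"
    if "a \<in> carrier (free_module R S)" "b \<in> carrier (free_module R S)" for a b
  proof -
    have "{s. a s \<oplus>\<^bsub>R\<^esub> b s \<noteq> \<zero>\<^bsub>R\<^esub>} \<subseteq> {s. a s \<noteq> \<zero>\<^bsub>R\<^esub>} \<union> {s. b s \<noteq> \<zero>\<^bsub>R\<^esub>}"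
      using that by (auto simp: free_module_simps)
    then show ?thesis
      using that by (auto simp: free_module_simps intro: finite_subset)
  qed
  have smult: "r \<odot>\<^bsub>free_module R S\<^esub> a \<in> carrier (free_module R S)"
    if "r \<in> carrier R" "a \<in> carrier (free_module R S)" for r a
  proof -
    have "{s. r \<otimes>\<^bsub>R\<^esub> a s \<noteq> \<zero>\<^bsub>R\<^esub>} \<subseteq> {s. a s \<noteq> \<zero>\<^bsub>R\<^esub>}"
      using that by auto
    then show ?thesis
      using that by (auto simp: free_module_simps intro: finite_subset)
  qed
  have "abelian_group (free_module R S)"
  proof (rule abelian_groupI)
    fix a assume a: "a \<in> carrier (free_module R S)"
    have "(\<ominus>\<^bsub>R\<^esub> \<one>\<^bsub>R\<^esub>) \<odot>\<^bsub>free_module R S\<^esub> a \<in> carrier (free_module R S)"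
      using smult a by simp
    moreover have "((\<ominus>\<^bsub>R\<^esub> \<one>\<^bsub>R\<^esub>) \<odot>\<^bsub>free_module R S\<^esub> a) \<oplus>\<^bsub>free_module R S\<^esub> a = \<zero>\<^bsub>free_module R S\<^esub>"
      using a by (auto simp: free_module_simps R.l_minus R.l_neg)
    ultimately show "\<exists>b\<in>carrier (free_module R S). b \<oplus>\<^bsub>free_module R S\<^esub> a = \<zero>\<^bsub>free_module R S\<^esub>"
      by blast
  next
    show "\<zero>\<^bsub>free_module R S\<^esub> \<in> carrier (free_module R S)" by (simp add: free_module_simps)
  next
    fix a b c assume "a \<in> carrier (free_module R S)" "b \<in> carrier (free_module R S)"
      "c \<in> carrier (free_module R S)"
    then show "a \<oplus>\<^bsub>free_module R S\<^esub> b \<oplus>\<^bsub>free_module R S\<^esub> c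
        = a \<oplus>\<^bsub>free_module R S\<^esub> (b \<oplus>\<^bsub>free_module R S\<^esub> c)"
      by (simp add: free_module_simps R.a_assoc)
  next
    fix a b assume "a \<in> carrier (free_module R S)" "b \<in> carrier (free_module R S)"
    then show "a \<oplus>\<^bsub>free_module R S\<^esub> b = b \<oplus>\<^bsub>free_module R S\<^esub> a"
      by (simp add: free_module_simps R.a_comm)
  next
    fix a assume "a \<in> carrier (free_module R S)"
    then show "\<zero>\<^bsub>free_module R S\<^esub> \<oplus>\<^bsub>free_module R S\<^esub> a = a"
      by (simp add: free_module_simps)
  qed (rule add)
  then show ?thesis
  proof (rule moduleI[OF assms])
    fix a b x assume "a \<in> carrier R" "b \<in> carrier R" "x \<in> carrier (free_module R S)"
    then show "(a \<oplus>\<^bsub>R\<^esub> b) \<odot>\<^bsub>free_module R S\<^esub> x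
        = (a \<odot>\<^bsub>free_module R S\<^esub> x) \<oplus>\<^bsub>free_module R S\<^esub> (b \<odot>\<^bsub>free_module R S\<^esub> x)"
      and "(a \<otimes>\<^bsub>R\<^esub> b) \<odot>\<^bsub>free_module R S\<^esub> x = a \<odot>\<^bsub>free_module R S\<^esub> (b \<odot>\<^bsub>free_module R S\<^esub> x)"
      by (simp_all add: free_module_simps R.l_distr R.m_assoc)
  next
    fix a x y assume "a \<in> carrier R" "x \<in> carrier (free_module R S)" "y \<in> carrier (free_module R S)"
    then show "a \<odot>\<^bsub>free_module R S\<^esub> (x \<oplus>\<^bsub>free_module R S\<^esub> y)
        = (a \<odot>\<^bsub>free_module R S\<^esub> x) \<oplus>\<^bsub>free_module R S\<^esub> (a \<odot>\<^bsub>free_module R S\<^esub> y)"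
      by (simp add: free_module_simps R.r_distr)
  next
    fix x assume "x \<in> carrier (free_module R S)"
    then show "\<one>\<^bsub>R\<^esub> \<odot>\<^bsub>free_module R S\<^esub> x = x" by (simp add: free_module_simps)
  qed (rule smult)
qed

lemma basis_elem_closed:
  assumes "cring R" "s \<in> S"
  shows "basis_elem R s \<in> carrier (free_module R S)"
proof -
  interpret R: cring R by fact
  show ?thesis using assms(2)
    by (auto simp: free_module_simps basis_elem_def intro: finite_subset[of _ "{s}"])
qed

text \<open>
  The linear extension of a family \<open>w\<close> of elements of \<open>M\<close>: it sends \<open>\<Sum>c\<^sub>s s\<close> to \<open>\<Sum>c\<^sub>s w\<^sub>s\<close>.
\<close>

definition lin_ext ::
  "('r, 'x) ring_scheme \<Rightarrow> ('r, 'm) module \<Rightarrow> ('s \<Rightarrow> 'm) \<Rightarrow> ('s \<Rightarrow> 'r) \<Rightarrow> 'm" where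
  "lin_ext R M w c = (\<Oplus>\<^bsub>M\<^esub>s\<in>{s. c s \<noteq> \<zero>\<^bsub>R\<^esub>}. c s \<odot>\<^bsub>M\<^esub> w s)"

lemma lin_ext_superset:
  assumes "module R M" "c \<in> carrier (free_module R S)" "w \<in> S \<rightarrow> carrier M"
    and "finite A" "{s. c s \<noteq> \<zero>\<^bsub>R\<^esub>} \<subseteq> A" "A \<subseteq> S"
  shows "lin_ext R M w c = (\<Oplus>\<^bsub>M\<^esub>s\<in>A. c s \<odot>\<^bsub>M\<^esub> w s)"
proof -
  interpret M: module R M by fact
  have "c s \<odot>\<^bsub>M\<^esub> w s \<in> carrier M" "\<zero>\<^bsub>R\<^esub> \<odot>\<^bsub>M\<^esub> w s = \<zero>\<^bsub>M\<^esub>" if "s \<in> A" for s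
    using assms that by (auto simp: free_module_simps Pi_iff subset_iff)
  then show ?thesis unfolding lin_ext_def
    using assms(4,5) by (intro M.add.finprod_mono_neutral_cong_left) auto
qed

lemma lin_ext_hom:
  assumes "module R M" "w \<in> S \<rightarrow> carrier M"
  shows "lin_ext R M w \<in> mod_hom R (free_module R S) M"
proof -
  interpret M: module R M by fact
  have supp: "{s. c s \<noteq> \<zero>\<^bsub>R\<^esub>} \<subseteq> S" "finite {s. c s \<noteq> \<zero>\<^bsub>R\<^esub>}" "\<And>s. c s \<in> carrier R"
    if "c \<in> carrier (free_module R S)" for c
    using that by (auto simp: free_module_simps)
  interpret F: module R "free_module R S" by (rule module_free_module) (rule M.is_cring)
  note sup = lin_ext_superset[OF assms(1) _ assms(2)]
  show ?thesis
  proof (rule mod_homI)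
    fix c assume c: "c \<in> carrier (free_module R S)"
    show "lin_ext R M w c \<in> carrier M"
      unfolding lin_ext_def using supp[OF c] assms(2) by (intro M.finsum_closed) auto
  next
    fix c d assume c: "c \<in> carrier (free_module R S)" and d: "d \<in> carrier (free_module R S)"
    let ?A = "{s. c s \<noteq> \<zero>\<^bsub>R\<^esub>} \<union> {s. d s \<noteq> \<zero>\<^bsub>R\<^esub>}"
    have A: "finite ?A" "?A \<subseteq> S" using supp[OF c] supp[OF d] by auto
    have w: "w s \<in> carrier M" if "s \<in> ?A" for s using that A(2) assms(2) by blast
    then have cw: "(\<lambda>s. c s \<odot>\<^bsub>M\<^esub> w s) \<in> ?A \<rightarrow> carrier M" "(\<lambda>s. d s \<odot>\<^bsub>M\<^esub> w s) \<in> ?A \<rightarrow> carrier M"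
      using supp(3)[OF c] supp(3)[OF d] by blast+
    have "{s. (c \<oplus>\<^bsub>free_module R S\<^esub> d) s \<noteq> \<zero>\<^bsub>R\<^esub>} \<subseteq> ?A"
      by (auto simp: free_module_simps)
    then have "lin_ext R M w (c \<oplus>\<^bsub>free_module R S\<^esub> d)
        = (\<Oplus>\<^bsub>M\<^esub>s\<in>?A. (c \<oplus>\<^bsub>free_module R S\<^esub> d) s \<odot>\<^bsub>M\<^esub> w s)"
      using sup c d A by (meson F.a_closed)
    also have "\<dots> = (\<Oplus>\<^bsub>M\<^esub>s\<in>?A. c s \<odot>\<^bsub>M\<^esub> w s \<oplus>\<^bsub>M\<^esub> d s \<odot>\<^bsub>M\<^esub> w s)"
    proof (intro M.finsum_cong' Pi_I)
      fix s assume s: "s \<in> ?A"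
      show "c s \<odot>\<^bsub>M\<^esub> w s \<oplus>\<^bsub>M\<^esub> d s \<odot>\<^bsub>M\<^esub> w s \<in> carrier M"
        using cw s by (intro M.a_closed) blast+
      show "(c \<oplus>\<^bsub>free_module R S\<^esub> d) s \<odot>\<^bsub>M\<^esub> w s = c s \<odot>\<^bsub>M\<^esub> w s \<oplus>\<^bsub>M\<^esub> d s \<odot>\<^bsub>M\<^esub> w s"
        using w[OF s] supp(3)[OF c] supp(3)[OF d] by (simp add: free_module_simps M.smult_l_distr)
    qed simp
    also have "\<dots> = (\<Oplus>\<^bsub>M\<^esub>s\<in>?A. c s \<odot>\<^bsub>M\<^esub> w s) \<oplus>\<^bsub>M\<^esub> (\<Oplus>\<^bsub>M\<^esub>s\<in>?A. d s \<odot>\<^bsub>M\<^esub> w s)"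
      by (rule M.finsum_addf[OF cw])
    finally show "lin_ext R M w (c \<oplus>\<^bsub>free_module R S\<^esub> d) = lin_ext R M w c \<oplus>\<^bsub>M\<^esub> lin_ext R M w d"
      using sup[OF c A(1) _ A(2)] sup[OF d A(1) _ A(2)] by simp
  next
    fix r c assume r: "r \<in> carrier R" and c: "c \<in> carrier (free_module R S)"
    let ?A = "{s. c s \<noteq> \<zero>\<^bsub>R\<^esub>}"
    have A: "finite ?A" "?A \<subseteq> S" using supp[OF c] by auto
    have w: "w s \<in> carrier M" if "s \<in> ?A" for s using that A(2) assms(2) by blast
    then have cw: "(\<lambda>s. c s \<odot>\<^bsub>M\<^esub> w s) \<in> ?A \<rightarrow> carrier M"
      using supp(3)[OF c] by blast
    have "{s. (r \<odot>\<^bsub>free_module R S\<^esub> c) s \<noteq> \<zero>\<^bsub>R\<^esub>} \<subseteq> ?A"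
      using r by (auto simp: free_module_simps)
    then have "lin_ext R M w (r \<odot>\<^bsub>free_module R S\<^esub> c)
        = (\<Oplus>\<^bsub>M\<^esub>s\<in>?A. (r \<odot>\<^bsub>free_module R S\<^esub> c) s \<odot>\<^bsub>M\<^esub> w s)"
      using sup r c A by (meson F.smult_closed)
    also have "\<dots> = (\<Oplus>\<^bsub>M\<^esub>s\<in>?A. r \<odot>\<^bsub>M\<^esub> (c s \<odot>\<^bsub>M\<^esub> w s))"
    proof (intro M.finsum_cong' Pi_I)
      fix s assume s: "s \<in> ?A"
      show "r \<odot>\<^bsub>M\<^esub> (c s \<odot>\<^bsub>M\<^esub> w s) \<in> carrier M"
        using r w[OF s] supp(3)[OF c] by simp
      show "(r \<odot>\<^bsub>free_module R S\<^esub> c) s \<odot>\<^bsub>M\<^esub> w s = r \<odot>\<^bsub>M\<^esub> (c s \<odot>\<^bsub>M\<^esub> w s)"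
        using w[OF s] r supp(3)[OF c] by (simp add: free_module_simps M.smult_assoc1)
    qed simp
    also have "\<dots> = r \<odot>\<^bsub>M\<^esub> (\<Oplus>\<^bsub>M\<^esub>s\<in>?A. c s \<odot>\<^bsub>M\<^esub> w s)"
      by (rule M.finsum_smult_ldistr[OF A(1) r cw, symmetric])
    finally show "lin_ext R M w (r \<odot>\<^bsub>free_module R S\<^esub> c) = r \<odot>\<^bsub>M\<^esub> lin_ext R M w c"
      by (simp add: lin_ext_def)
  qed
qed

lemma lin_ext_basis_elem:
  assumes "module R M" "w \<in> S \<rightarrow> carrier M" "s \<in> S"
  shows "lin_ext R M w (basis_elem R s) = w s"
proof -
  interpret M: module R M by fact
  have "lin_ext R M w (basis_elem R s) = (\<Oplus>\<^bsub>M\<^esub>t\<in>{s}. basis_elem R s t \<odot>\<^bsub>M\<^esub> w t)"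
    using assms by (intro lin_ext_superset[where S = S] basis_elem_closed M.is_cring)
      (auto simp: basis_elem_def)
  also have "\<dots> = w s"
    using assms(2,3) by (simp add: basis_elem_def Pi_iff)
  finally show ?thesis .
qed

lemma mod_hom_lin_ext_family:
  assumes "module R P" "c \<in> carrier (free_module R S)"
    and w: "\<And>s. s \<in> S \<Longrightarrow> (\<lambda>x. w x s) \<in> mod_hom R M P"
  shows "(\<lambda>x. lin_ext R P (w x) c) \<in> mod_hom R M P"
proof -
  interpret P: module R P by fact
  have supp: "{s. c s \<noteq> \<zero>\<^bsub>R\<^esub>} \<subseteq> S" "finite {s. c s \<noteq> \<zero>\<^bsub>R\<^esub>}" "\<And>s. c s \<in> carrier R"
    using assms(2) by (auto simp: free_module_simps)
  have closed: "w x s \<in> carrier P" if "c s \<noteq> \<zero>\<^bsub>R\<^esub>" "x \<in> carrier M" for x s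
    using mod_hom_closed[OF w, of s x] that supp by auto
  show ?thesis
  proof (rule mod_homI)
    fix x assume "x \<in> carrier M"
    then show "lin_ext R P (w x) c \<in> carrier P"
      unfolding lin_ext_def using supp closed by (intro P.finsum_closed) auto
  next
    fix x y assume xy: "x \<in> carrier M" "y \<in> carrier M"
    have "lin_ext R P (w (x \<oplus>\<^bsub>M\<^esub> y)) c
      = (\<Oplus>\<^bsub>P\<^esub>s\<in>{s. c s \<noteq> \<zero>\<^bsub>R\<^esub>}. c s \<odot>\<^bsub>P\<^esub> w x s \<oplus>\<^bsub>P\<^esub> c s \<odot>\<^bsub>P\<^esub> w y s)"
      unfolding lin_ext_def using supp xy closed mod_hom_add[OF w]
      by (intro P.finsum_cong') (auto simp: P.smult_r_distr subset_iff)
    also have "\<dots> = lin_ext R P (w x) c \<oplus>\<^bsub>P\<^esub> lin_ext R P (w y) c"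
      unfolding lin_ext_def using supp xy closed by (intro P.finsum_addf) auto
    finally show "lin_ext R P (w (x \<oplus>\<^bsub>M\<^esub> y)) c = lin_ext R P (w x) c \<oplus>\<^bsub>P\<^esub> lin_ext R P (w y) c" .
  next
    fix r x assume rx: "r \<in> carrier R" "x \<in> carrier M"
    have "lin_ext R P (w (r \<odot>\<^bsub>M\<^esub> x)) c
      = (\<Oplus>\<^bsub>P\<^esub>s\<in>{s. c s \<noteq> \<zero>\<^bsub>R\<^esub>}. r \<odot>\<^bsub>P\<^esub> (c s \<odot>\<^bsub>P\<^esub> w x s))"
      unfolding lin_ext_def using supp rx closed mod_hom_smult[OF w]
      by (intro P.finsum_cong')
        (auto simp: P.smult_assoc1[symmetric] P.m_comm subset_iff)
    also have "\<dots> = r \<odot>\<^bsub>P\<^esub> lin_ext R P (w x) c"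
      unfolding lin_ext_def using supp rx closed by (intro P.finsum_smult_ldistr[symmetric]) auto
    finally show "lin_ext R P (w (r \<odot>\<^bsub>M\<^esub> x)) c = r \<odot>\<^bsub>P\<^esub> lin_ext R P (w x) c" .
  qed
qed

lemma free_module_hom_eq:
  assumes "module R P" "f \<in> mod_hom R (free_module R S) P" "g \<in> mod_hom R (free_module R S) P"
    and basis: "\<And>s. s \<in> S \<Longrightarrow> f (basis_elem R s) = g (basis_elem R s)"
    and "c \<in> carrier (free_module R S)"
  shows "f c = g c"
proof -
  interpret P: module R P by fact
  interpret F: module R "free_module R S" by (rule module_free_module) (rule P.is_cring)
  have "f c = g c" if "finite A" "c \<in> carrier (free_module R S)" "{s. c s \<noteq> \<zero>\<^bsub>R\<^esub>} \<subseteq> A" for A c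
    using that
  proof (induction A arbitrary: c)
    case empty
    then have "c = \<zero>\<^bsub>free_module R S\<^esub>" by (auto simp: free_module_simps)
    then show ?case
      using mod_hom_zero[OF F.module_axioms P.module_axioms assms(2)]
        mod_hom_zero[OF F.module_axioms P.module_axioms assms(3)] by metis
  next
    case (insert a A)
    show ?case
    proof (cases "c a = \<zero>\<^bsub>R\<^esub>")
      case True
      then show ?thesis using insert by (intro insert.IH) auto
    next
      case False
      then have a: "a \<in> S" "c a \<in> carrier R" using insert.prems by (auto simp: free_module_simps)
      let ?b = "basis_elem R a" and ?c = "c(a := \<zero>\<^bsub>R\<^esub>)"
      have b: "?b \<in> carrier (free_module R S)" by (intro basis_elem_closed P.is_cring a)
      have c': "?c \<in> carrier (free_module R S)"
        using insert.prems(1)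
        by (auto simp: free_module_simps intro: rev_finite_subset[of "{s. c s \<noteq> \<zero>\<^bsub>R\<^esub>}"])
      have "c = ?c \<oplus>\<^bsub>free_module R S\<^esub> (c a \<odot>\<^bsub>free_module R S\<^esub> ?b)"
        using insert.prems(1) by (auto simp: free_module_simps basis_elem_def)
      moreover have "f (?c \<oplus>\<^bsub>free_module R S\<^esub> (c a \<odot>\<^bsub>free_module R S\<^esub> ?b)) = f ?c \<oplus>\<^bsub>P\<^esub> c a \<odot>\<^bsub>P\<^esub> f ?b"
        "g (?c \<oplus>\<^bsub>free_module R S\<^esub> (c a \<odot>\<^bsub>free_module R S\<^esub> ?b)) = g ?c \<oplus>\<^bsub>P\<^esub> c a \<odot>\<^bsub>P\<^esub> g ?b"
        using mod_homD[OF assms(2)] mod_homD[OF assms(3)] b c' a by simp_all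
      moreover have "f ?c = g ?c" using insert.prems(2) by (intro insert.IH c') auto
      ultimately show ?thesis using basis[OF a(1)] by simp
    qed
  qed
  then show ?thesis using assms(5) by (auto simp: free_module_simps)
qed


section \<open>Quotient modules\<close>

lemma quotient_module_simps:
  "carrier (quotient_module M N) = a_rcosets\<^bsub>M\<^esub> N"
  "X \<oplus>\<^bsub>quotient_module M N\<^esub> Y = X <+>\<^bsub>M\<^esub> Y"
  "r \<odot>\<^bsub>quotient_module M N\<^esub> X = (\<Union>x\<in>X. N +>\<^bsub>M\<^esub> (r \<odot>\<^bsub>M\<^esub> x))"
  by (simp_all add: quotient_module_def)

lemma submodule_abelian_subgroup:
  assumes "module R M" "submodule N R M"
  shows "abelian_subgroup N M"
proof -
  interpret M: module R M by fact
  show ?thesis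
    using submodule.axioms(1)[OF assms(2)] M.abelian_group_axioms
    by (auto intro!: abelian_subgroupI3 additive_subgroupI)
qed

lemma quotient_module_proj:
  assumes "module R M" "submodule N R M"
  shows "(\<lambda>x. N +>\<^bsub>M\<^esub> x) \<in> mod_hom R M (quotient_module M N)"
proof -
  interpret M: module R M by fact
  interpret N: abelian_subgroup N M using submodule_abelian_subgroup assms by blast
  show ?thesis
  proof (rule mod_homI)
    fix x assume "x \<in> carrier M"
    then show "N +>\<^bsub>M\<^esub> x \<in> carrier (quotient_module M N)"
      by (auto simp: quotient_module_simps intro!: M.a_rcosetsI N.a_subset)
  next
    fix x y assume "x \<in> carrier M" "y \<in> carrier M"
    then show "N +>\<^bsub>M\<^esub> (x \<oplus>\<^bsub>M\<^esub> y) = (N +>\<^bsub>M\<^esub> x) \<oplus>\<^bsub>quotient_module M N\<^esub> (N +>\<^bsub>M\<^esub> y)"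
      by (simp add: quotient_module_simps N.a_rcos_sum)
  next
    fix r x assume r: "r \<in> carrier R" and x: "x \<in> carrier M"
    have "N +>\<^bsub>M\<^esub> (r \<odot>\<^bsub>M\<^esub> y) = N +>\<^bsub>M\<^esub> (r \<odot>\<^bsub>M\<^esub> x)" if y: "y \<in> N +>\<^bsub>M\<^esub> x" for y
    proof -
      obtain n where n: "n \<in> N" "y = n \<oplus>\<^bsub>M\<^esub> x" using y by (auto simp: a_r_coset_def')
      then have "r \<odot>\<^bsub>M\<^esub> y = r \<odot>\<^bsub>M\<^esub> n \<oplus>\<^bsub>M\<^esub> r \<odot>\<^bsub>M\<^esub> x"
        using r x by (simp add: M.smult_r_distr)
      moreover have "r \<odot>\<^bsub>M\<^esub> n \<in> N" using M.submoduleE(4)[OF assms(2)] r n by blast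
      ultimately have "r \<odot>\<^bsub>M\<^esub> y \<in> N +>\<^bsub>M\<^esub> (r \<odot>\<^bsub>M\<^esub> x)" by (auto simp: a_r_coset_def')
      then show ?thesis using r x N.a_repr_independence' by (metis M.smult_closed)
    qed
    then have "(\<Union>y\<in>N +>\<^bsub>M\<^esub> x. N +>\<^bsub>M\<^esub> (r \<odot>\<^bsub>M\<^esub> y)) = (\<Union>y\<in>N +>\<^bsub>M\<^esub> x. N +>\<^bsub>M\<^esub> (r \<odot>\<^bsub>M\<^esub> x))"
      by (rule SUP_cong[OF refl])
    then show "N +>\<^bsub>M\<^esub> (r \<odot>\<^bsub>M\<^esub> x) = r \<odot>\<^bsub>quotient_module M N\<^esub> (N +>\<^bsub>M\<^esub> x)"
      unfolding quotient_module_simps using N.a_rcos_self[OF x] by blast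
  qed
qed

lemma quotient_moduleE:
  assumes "X \<in> carrier (quotient_module M N)"
  obtains x where "x \<in> carrier M" "X = N +>\<^bsub>M\<^esub> x"
  using assms by (auto simp: quotient_module_simps A_RCOSETS_def')

lemma quotient_module_closed:
  assumes "module R M" "submodule N R M"
  shows "X \<in> carrier (quotient_module M N) \<Longrightarrow> Y \<in> carrier (quotient_module M N)
      \<Longrightarrow> X \<oplus>\<^bsub>quotient_module M N\<^esub> Y \<in> carrier (quotient_module M N)"
    and "r \<in> carrier R \<Longrightarrow> X \<in> carrier (quotient_module M N)
      \<Longrightarrow> r \<odot>\<^bsub>quotient_module M N\<^esub> X \<in> carrier (quotient_module M N)"
proof -
  interpret M: module R M by fact
  note proj = mod_homD[OF quotient_module_proj[OF assms]]
  show "X \<oplus>\<^bsub>quotient_module M N\<^esub> Y \<in> carrier (quotient_module M N)"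
    if "X \<in> carrier (quotient_module M N)" "Y \<in> carrier (quotient_module M N)"
    using that by (metis M.a_closed proj(1,2) quotient_moduleE)
  show "r \<odot>\<^bsub>quotient_module M N\<^esub> X \<in> carrier (quotient_module M N)"
    if "r \<in> carrier R" "X \<in> carrier (quotient_module M N)"
    using that by (metis M.smult_closed proj(1,3) quotient_moduleE)
qed

text \<open>The universal property of the quotient; the lift is computed on chosen representatives.\<close>

lemma quotient_module_lift:
  assumes "module R M" "module R P" "submodule N R M"
    and h: "h \<in> mod_hom R M P" and null: "\<And>x. x \<in> N \<Longrightarrow> h x = \<zero>\<^bsub>P\<^esub>"
  obtains f where "f \<in> carrier (Hom_module R (quotient_module M N) P)"
    "\<And>x. x \<in> carrier M \<Longrightarrow> f (N +>\<^bsub>M\<^esub> x) = h x"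
proof -
  interpret M: module R M by fact
  interpret P: module R P by fact
  interpret N: abelian_subgroup N M using submodule_abelian_subgroup assms by blast
  let ?Q = "quotient_module M N"
  note proj = mod_homD[OF quotient_module_proj[OF assms(1,3)]]
  define f where "f = (\<lambda>X\<in>carrier ?Q. h (SOME x. x \<in> X))"
  have f: "f (N +>\<^bsub>M\<^esub> x) = h x" if x: "x \<in> carrier M" for x
  proof -
    define y where "y = (SOME y. y \<in> N +>\<^bsub>M\<^esub> x)"
    have "y \<in> N +>\<^bsub>M\<^esub> x" unfolding y_def using N.a_rcos_self[OF x] by (rule someI)
    then obtain n where n: "n \<in> N" "y = n \<oplus>\<^bsub>M\<^esub> x" by (auto simp: a_r_coset_def')
    then have "h y = h x"
      using mod_homD[OF h] null x by simp
    then show ?thesis using proj(1) x by (simp add: f_def y_def)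
  qed
  have "f \<in> mod_hom R ?Q P"
  proof (rule mod_homI)
    fix X assume "X \<in> carrier ?Q"
    then obtain x where "x \<in> carrier M" "X = N +>\<^bsub>M\<^esub> x" by (rule quotient_moduleE)
    then show "f X \<in> carrier P" using f mod_hom_closed[OF h] by simp
  next
    fix X Y assume "X \<in> carrier ?Q" "Y \<in> carrier ?Q"
    then obtain x y where "x \<in> carrier M" "X = N +>\<^bsub>M\<^esub> x" "y \<in> carrier M" "Y = N +>\<^bsub>M\<^esub> y"
      by (metis quotient_moduleE)
    then show "f (X \<oplus>\<^bsub>?Q\<^esub> Y) = f X \<oplus>\<^bsub>P\<^esub> f Y"
      using f mod_homD[OF h] by (simp flip: proj(2))
  next
    fix r X assume r: "r \<in> carrier R" and "X \<in> carrier ?Q"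
    then obtain x where "x \<in> carrier M" "X = N +>\<^bsub>M\<^esub> x" by (metis quotient_moduleE)
    then show "f (r \<odot>\<^bsub>?Q\<^esub> X) = r \<odot>\<^bsub>P\<^esub> f X"
      using f r mod_homD[OF h] by (simp flip: proj(3))
  qed
  moreover have "f \<in> extensional (carrier ?Q)" by (simp add: f_def)
  ultimately show ?thesis using f that by (simp add: Hom_module_simps)
qed

lemma submodule_submodule_span:
  assumes "module R M" "A \<subseteq> carrier M"
  shows "submodule (submodule_span R M A) R M"
proof -
  interpret M: module R M by fact
  have carrier: "carrier M \<in> {N. submodule N R M \<and> A \<subseteq> N}"
    using M.carrier_is_submodule assms(2) by simp
  have zero: "\<zero>\<^bsub>M\<^esub> \<in> N" if "submodule N R M" for N
    using subgroup.one_closed[OF submodule.axioms(1)[OF that]] by simp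
  show ?thesis unfolding submodule_span_def
  proof (rule M.submoduleI)
    show "\<Inter> {N. submodule N R M \<and> A \<subseteq> N} \<subseteq> carrier M" using carrier by (rule Inter_lower)
  next
    show "\<zero>\<^bsub>M\<^esub> \<in> \<Inter> {N. submodule N R M \<and> A \<subseteq> N}" using zero by blast
  next
    fix a assume "a \<in> \<Inter> {N. submodule N R M \<and> A \<subseteq> N}"
    then show "\<ominus>\<^bsub>M\<^esub> a \<in> \<Inter> {N. submodule N R M \<and> A \<subseteq> N}" using M.submoduleE(3) by blast
  next
    fix a b assume "a \<in> \<Inter> {N. submodule N R M \<and> A \<subseteq> N}" "b \<in> \<Inter> {N. submodule N R M \<and> A \<subseteq> N}"
    then show "a \<oplus>\<^bsub>M\<^esub> b \<in> \<Inter> {N. submodule N R M \<and> A \<subseteq> N}" using M.submoduleE(5) by blast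
  next
    fix r a assume "r \<in> carrier R" "a \<in> \<Inter> {N. submodule N R M \<and> A \<subseteq> N}"
    then show "r \<odot>\<^bsub>M\<^esub> a \<in> \<Inter> {N. submodule N R M \<and> A \<subseteq> N}" using M.submoduleE(4) by blast
  qed
qed

lemma mod_hom_null_on_span:
  assumes "module R M" "module R P" "h \<in> mod_hom R M P" "A \<subseteq> carrier M"
    and "\<And>a. a \<in> A \<Longrightarrow> h a = \<zero>\<^bsub>P\<^esub>" and "x \<in> submodule_span R M A"
  shows "h x = \<zero>\<^bsub>P\<^esub>"
proof -
  interpret M: module R M by fact
  interpret P: module R P by fact
  have "submodule {x \<in> carrier M. h x = \<zero>\<^bsub>P\<^esub>} R M"
    using mod_homD[OF assms(3)] mod_hom_zero[OF assms(1-3)] mod_hom_minus[OF assms(1-3)]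
    by (intro M.submoduleI) auto
  then show ?thesis using assms(4-6) by (auto simp: submodule_span_def)
qed


section \<open>Tensor powers and multilinear maps\<close>

text \<open>
  Multilinear maps on \<open>n\<close>-tuples, given as functions on lists; their values on other lists are
  unconstrained.
\<close>

definition multilinear ::
  "('r, 'x) ring_scheme \<Rightarrow> ('r, 'm) module \<Rightarrow> ('r, 'p) module \<Rightarrow> nat \<Rightarrow> ('m list \<Rightarrow> 'p) \<Rightarrow> bool"
where
  "multilinear R M P n \<phi> \<longleftrightarrow>
    \<phi> \<in> tuples (carrier M) n \<rightarrow> carrier P \<and>
    (\<forall>us vs. set us \<union> set vs \<subseteq> carrier M \<and> Suc (length us + length vs) = n \<longrightarrow>
       (\<lambda>x. \<phi> (us @ [x] @ vs)) \<in> mod_hom R M P)"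

lemma multilinear_closed:
  "multilinear R M P n \<phi> \<Longrightarrow> xs \<in> tuples (carrier M) n \<Longrightarrow> \<phi> xs \<in> carrier P"
  by (auto simp: multilinear_def)

lemma multilinear_hom:
  "multilinear R M P n \<phi> \<Longrightarrow> set us \<subseteq> carrier M \<Longrightarrow> set vs \<subseteq> carrier M
    \<Longrightarrow> Suc (length us + length vs) = n \<Longrightarrow> (\<lambda>x. \<phi> (us @ x # vs)) \<in> mod_hom R M P"
  by (auto simp: multilinear_def)

lemma module_free_on_tuples:
  "cring R \<Longrightarrow> module R (free_on_tuples R M n)"
  by (simp add: free_on_tuples_def module_free_module)

lemma multilinear_relations_closed:
  assumes "module R M"
  shows "multilinear_relations R M n \<subseteq> carrier (free_on_tuples R M n)"
proof -
  interpret M: module R M by fact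
  interpret F: module R "free_on_tuples R M n" by (rule module_free_on_tuples) (rule M.is_cring)
  have "basis_elem R xs \<in> carrier (free_on_tuples R M n)" if "xs \<in> tuples (carrier M) n" for xs
    unfolding free_on_tuples_def using that by (intro basis_elem_closed M.is_cring)
  then have b: "basis_elem R (us @ [x] @ vs) \<in> carrier (free_on_tuples R M n)"
    if "set us \<union> set vs \<union> {x} \<subseteq> carrier M" "Suc (length us + length vs) = n" for us vs x
    using that by (simp add: tuples_def)
  show ?thesis
  proof
    fix a assume "a \<in> multilinear_relations R M n"
    then consider
        (add) us vs x y where "set us \<union> set vs \<union> {x, y} \<subseteq> carrier M" "Suc (length us + length vs) = n"
          "a = basis_elem R (us @ [x \<oplus>\<^bsub>M\<^esub> y] @ vs) \<ominus>\<^bsub>free_on_tuples R M n\<^esub>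
            (basis_elem R (us @ [x] @ vs) \<oplus>\<^bsub>free_on_tuples R M n\<^esub> basis_elem R (us @ [y] @ vs))"
      | (smult) us vs r x where "set us \<union> set vs \<union> {x} \<subseteq> carrier M" "r \<in> carrier R"
          "Suc (length us + length vs) = n"
          "a = basis_elem R (us @ [r \<odot>\<^bsub>M\<^esub> x] @ vs) \<ominus>\<^bsub>free_on_tuples R M n\<^esub>
            (r \<odot>\<^bsub>free_on_tuples R M n\<^esub> basis_elem R (us @ [x] @ vs))"
      unfolding multilinear_relations_def Let_def by blast
    then show "a \<in> carrier (free_on_tuples R M n)"
    proof cases
      case add
      then show ?thesis
        by (simp only: add(3)) (intro F.minus_closed F.a_closed b; simp)
    next
      case smult
      then show ?thesis
        by (simp only: smult(4)) (intro F.minus_closed F.smult_closed b; simp)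
    qed
  qed
qed

lemma submodule_relation_submodule:
  "module R M \<Longrightarrow> submodule (relation_submodule R M n) R (free_on_tuples R M n)"
  unfolding relation_submodule_def
  by (intro submodule_submodule_span multilinear_relations_closed module_free_on_tuples)
    (auto intro: module.axioms)

lemma pure_tensor_eq:
  "xs \<in> tuples (carrier M) n \<Longrightarrow>
    pure_tensor R M xs = relation_submodule R M n +>\<^bsub>free_on_tuples R M n\<^esub> basis_elem R xs"
  by (auto simp: pure_tensor_def tuples_def)

lemma tensor_power_closed:
  assumes "module R M"
  shows "X \<in> carrier (tensor_power R M n) \<Longrightarrow> Y \<in> carrier (tensor_power R M n)
      \<Longrightarrow> X \<oplus>\<^bsub>tensor_power R M n\<^esub> Y \<in> carrier (tensor_power R M n)"
    and "r \<in> carrier R \<Longrightarrow> X \<in> carrier (tensor_power R M n)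
      \<Longrightarrow> r \<odot>\<^bsub>tensor_power R M n\<^esub> X \<in> carrier (tensor_power R M n)"
  using quotient_module_closed[OF module_free_on_tuples submodule_relation_submodule[OF assms]]
    module.axioms(1)[OF assms]
  unfolding tensor_power_def by blast+

lemma pure_tensor_closed:
  assumes "module R M" "xs \<in> tuples (carrier M) n"
  shows "pure_tensor R M xs \<in> carrier (tensor_power R M n)"
proof -
  have R: "cring R" using assms(1) by (rule module.axioms)
  show ?thesis
    unfolding pure_tensor_eq[OF assms(2)] tensor_power_def
    using mod_hom_closed[OF quotient_module_proj[OF module_free_on_tuples[OF R]
          submodule_relation_submodule[OF assms(1)]]]
      basis_elem_closed[OF R assms(2)]
    by (simp add: free_on_tuples_def)
qed

text \<open>
  Existence in the universal property of the tensor power; uniqueness is \<open>tensor_power_hom_eq\<close> below.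
\<close>

lemma tensor_power_lift:
  assumes "module R M" "module R P" "multilinear R M P n \<phi>"
  obtains f where "f \<in> carrier (Hom_module R (tensor_power R M n) P)"
    "\<And>xs. xs \<in> tuples (carrier M) n \<Longrightarrow> f (pure_tensor R M xs) = \<phi> xs"
proof -
  interpret M: module R M by fact
  interpret P: module R P by fact
  let ?F = "free_on_tuples R M n"
  interpret F: module R ?F by (rule module_free_on_tuples) (rule M.is_cring)
  let ?h = "lin_ext R P \<phi>"
  have \<phi>: "\<phi> \<in> tuples (carrier M) n \<rightarrow> carrier P" using assms(3) by (auto simp: multilinear_def)
  have h: "?h \<in> mod_hom R ?F P"
    unfolding free_on_tuples_def by (rule lin_ext_hom[OF assms(2) \<phi>])
  have b: "basis_elem R xs \<in> carrier ?F" if "xs \<in> tuples (carrier M) n" for xs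
    unfolding free_on_tuples_def using that by (intro basis_elem_closed M.is_cring)
  have hb: "?h (basis_elem R xs) = \<phi> xs" if "xs \<in> tuples (carrier M) n" for xs
    by (rule lin_ext_basis_elem[OF assms(2) \<phi> that])
  have null: "?h x = \<zero>\<^bsub>P\<^esub>" if "x \<in> relation_submodule R M n" for x
  proof (rule mod_hom_null_on_span[OF F.module_axioms assms(2) h multilinear_relations_closed[OF assms(1)]])
    show "x \<in> submodule_span R (free_on_tuples R M n) (multilinear_relations R M n)"
      using that by (simp add: relation_submodule_def)
  next
    fix a assume "a \<in> multilinear_relations R M n"
    then consider
        (add) us vs x y where "set us \<union> set vs \<union> {x, y} \<subseteq> carrier M" "Suc (length us + length vs) = n"
          "a = basis_elem R (us @ [x \<oplus>\<^bsub>M\<^esub> y] @ vs) \<ominus>\<^bsub>?F\<^esub>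
            (basis_elem R (us @ [x] @ vs) \<oplus>\<^bsub>?F\<^esub> basis_elem R (us @ [y] @ vs))"
      | (smult) us vs r x where "set us \<union> set vs \<union> {x} \<subseteq> carrier M" "r \<in> carrier R"
          "Suc (length us + length vs) = n"
          "a = basis_elem R (us @ [r \<odot>\<^bsub>M\<^esub> x] @ vs) \<ominus>\<^bsub>?F\<^esub>
            (r \<odot>\<^bsub>?F\<^esub> basis_elem R (us @ [x] @ vs))"
      unfolding multilinear_relations_def Let_def by blast
    then show "?h a = \<zero>\<^bsub>P\<^esub>"
    proof cases
      case add
      have t: "us @ z # vs \<in> tuples (carrier M) n" if "z \<in> carrier M" for z
        using add that by (auto simp: tuples_def)
      have "\<phi> (us @ (x \<oplus>\<^bsub>M\<^esub> y) # vs) = \<phi> (us @ x # vs) \<oplus>\<^bsub>P\<^esub> \<phi> (us @ y # vs)"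
        using mod_hom_add[OF multilinear_hom[OF assms(3)]] add by simp
      then show ?thesis
        using add t multilinear_closed[OF assms(3)]
        by (simp add: a_minus_def mod_homD[OF h] mod_hom_minus[OF F.module_axioms assms(2) h]
            b hb P.r_neg)
    next
      case smult
      have t: "us @ z # vs \<in> tuples (carrier M) n" if "z \<in> carrier M" for z
        using smult that by (auto simp: tuples_def)
      have "\<phi> (us @ (r \<odot>\<^bsub>M\<^esub> x) # vs) = r \<odot>\<^bsub>P\<^esub> \<phi> (us @ x # vs)"
        using mod_hom_smult[OF multilinear_hom[OF assms(3)]] smult by simp
      then show ?thesis
        using smult t multilinear_closed[OF assms(3)]
        by (simp add: a_minus_def mod_homD[OF h] mod_hom_minus[OF F.module_axioms assms(2) h]
            b hb P.r_neg)
    qed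
  qed
  obtain f where f: "f \<in> carrier (Hom_module R (tensor_power R M n) P)"
      "\<And>x. x \<in> carrier ?F \<Longrightarrow> f (relation_submodule R M n +>\<^bsub>?F\<^esub> x) = ?h x"
    unfolding tensor_power_def
    by (rule quotient_module_lift[OF F.module_axioms assms(2)
          submodule_relation_submodule[OF assms(1)] h null]) blast+
  show ?thesis
    by (rule that[OF f(1)]) (simp add: pure_tensor_eq f(2) b hb)
qed

lemma multilinear_pure_tensor:
  assumes "module R M" "module R P" "f \<in> mod_hom R (tensor_power R M n) P"
  shows "multilinear R M P n (\<lambda>xs. f (pure_tensor R M xs))"
proof -
  interpret M: module R M by fact
  interpret P: module R P by fact
  let ?F = "free_on_tuples R M n" and ?N = "relation_submodule R M n"
  interpret F: module R ?F by (rule module_free_on_tuples) (rule M.is_cring)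
  define h where "h = (\<lambda>x. f (?N +>\<^bsub>?F\<^esub> x))"
  have h: "h \<in> mod_hom R ?F P"
    unfolding h_def
    using mod_hom_comp[OF quotient_module_proj[OF F.module_axioms
        submodule_relation_submodule[OF assms(1)]]] assms(3)
    by (simp add: tensor_power_def)
  have ab: "abelian_subgroup ?N ?F"
    using submodule_abelian_subgroup[OF F.module_axioms submodule_relation_submodule[OF assms(1)]] .
  have null: "h x = \<zero>\<^bsub>P\<^esub>" if "x \<in> multilinear_relations R M n" for x
  proof -
    have x: "x \<in> ?N" using that by (auto simp: relation_submodule_def submodule_span_def)
    interpret N: abelian_subgroup ?N ?F by (rule ab)
    have "x \<in> carrier ?F" using x by simp
    then have "?N +>\<^bsub>?F\<^esub> x = ?N +>\<^bsub>?F\<^esub> \<zero>\<^bsub>?F\<^esub>"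
      using x N.a_subset
      by (metis F.a_coset_add_zero F.a_coset_join2 N.is_additive_subgroup
          additive_subgroup.a_subgroup)
    then have "h x = h \<zero>\<^bsub>?F\<^esub>" by (simp add: h_def)
    then show ?thesis using mod_hom_zero[OF F.module_axioms assms(2) h] by simp
  qed
  have b: "basis_elem R xs \<in> carrier ?F" if "xs \<in> tuples (carrier M) n" for xs
    unfolding free_on_tuples_def using that by (intro basis_elem_closed M.is_cring)
  have pt: "f (pure_tensor R M xs) = h (basis_elem R xs)" if "xs \<in> tuples (carrier M) n" for xs
    using that by (simp add: pure_tensor_eq h_def)
  have minus: "h x = h y" if "x \<ominus>\<^bsub>?F\<^esub> y \<in> multilinear_relations R M n"
    "x \<in> carrier ?F" "y \<in> carrier ?F" for x y
    using null[OF that(1)] that mod_homD[OF h] mod_hom_minus[OF F.module_axioms assms(2) h]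
    by (simp add: a_minus_def P.add.inv_solve_right')
  show ?thesis unfolding multilinear_def
  proof (intro conjI allI impI)
    show "(\<lambda>xs. f (pure_tensor R M xs)) \<in> tuples (carrier M) n \<rightarrow> carrier P"
      using b pt mod_hom_closed[OF h] by auto
  next
    fix us vs assume uv: "set us \<union> set vs \<subseteq> carrier M \<and> Suc (length us + length vs) = n"
    have t: "us @ [z] @ vs \<in> tuples (carrier M) n" if "z \<in> carrier M" for z
      using uv that by (auto simp: tuples_def)
    show "(\<lambda>x. f (pure_tensor R M (us @ [x] @ vs))) \<in> mod_hom R M P"
    proof (rule mod_homI)
      fix x assume "x \<in> carrier M"
      then show "f (pure_tensor R M (us @ [x] @ vs)) \<in> carrier P"
        by (simp only: pt t b mod_hom_closed[OF h])
    next
      fix x y assume xy: "x \<in> carrier M" "y \<in> carrier M"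
      have "h (basis_elem R (us @ [x \<oplus>\<^bsub>M\<^esub> y] @ vs))
          = h (basis_elem R (us @ [x] @ vs) \<oplus>\<^bsub>?F\<^esub> basis_elem R (us @ [y] @ vs))"
      proof (rule minus)
        show "basis_elem R (us @ [x \<oplus>\<^bsub>M\<^esub> y] @ vs) \<ominus>\<^bsub>?F\<^esub>
            (basis_elem R (us @ [x] @ vs) \<oplus>\<^bsub>?F\<^esub> basis_elem R (us @ [y] @ vs)) \<in> multilinear_relations R M n"
          unfolding multilinear_relations_def Let_def using xy uv
          by (intro UnI1 CollectI exI[of _ us] exI[of _ vs] exI[of _ x] exI[of _ y]) auto
      qed (use xy in \<open>intro b t F.a_closed; simp\<close>)+
      then show "f (pure_tensor R M (us @ [x \<oplus>\<^bsub>M\<^esub> y] @ vs))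
          = f (pure_tensor R M (us @ [x] @ vs)) \<oplus>\<^bsub>P\<^esub> f (pure_tensor R M (us @ [y] @ vs))"
        using xy by (simp only: pt t b mod_hom_add[OF h] M.a_closed)
    next
      fix r x assume rx: "r \<in> carrier R" "x \<in> carrier M"
      have "h (basis_elem R (us @ [r \<odot>\<^bsub>M\<^esub> x] @ vs)) = h (r \<odot>\<^bsub>?F\<^esub> basis_elem R (us @ [x] @ vs))"
      proof (rule minus)
        show "basis_elem R (us @ [r \<odot>\<^bsub>M\<^esub> x] @ vs) \<ominus>\<^bsub>?F\<^esub>
            (r \<odot>\<^bsub>?F\<^esub> basis_elem R (us @ [x] @ vs)) \<in> multilinear_relations R M n"
          unfolding multilinear_relations_def Let_def using rx uv
          by (intro UnI2 CollectI exI[of _ us] exI[of _ vs] exI[of _ r] exI[of _ x]) auto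
      qed (use rx in \<open>intro b t F.smult_closed; simp\<close>)+
      then show "f (pure_tensor R M (us @ [r \<odot>\<^bsub>M\<^esub> x] @ vs)) = r \<odot>\<^bsub>P\<^esub> f (pure_tensor R M (us @ [x] @ vs))"
        using rx by (simp only: pt t b mod_hom_smult[OF h] M.smult_closed)
    qed
  qed
qed

lemma tensor_power_hom_eq:
  assumes "module R M" "module R P"
    and "f \<in> carrier (Hom_module R (tensor_power R M n) P)"
    and "f' \<in> carrier (Hom_module R (tensor_power R M n) P)"
    and eq: "\<And>xs. xs \<in> tuples (carrier M) n \<Longrightarrow> f (pure_tensor R M xs) = f' (pure_tensor R M xs)"
  shows "f = f'"
proof -
  have R: "cring R" using assms(1) by (rule module.axioms)
  let ?F = "free_on_tuples R M n" and ?N = "relation_submodule R M n"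
  have hom: "(\<lambda>x. g (?N +>\<^bsub>?F\<^esub> x)) \<in> mod_hom R (free_module R (tuples (carrier M) n)) P"
    if "g \<in> carrier (Hom_module R (tensor_power R M n) P)" for g
  proof -
    have "g \<in> mod_hom R (quotient_module ?F ?N) P"
      using that by (simp add: tensor_power_def Hom_module_simps)
    from mod_hom_comp[OF quotient_module_proj[OF module_free_on_tuples[OF R]
        submodule_relation_submodule[OF assms(1)]] this]
    show ?thesis by (simp only: free_on_tuples_def)
  qed
  have "f (?N +>\<^bsub>?F\<^esub> c) = f' (?N +>\<^bsub>?F\<^esub> c)" if "c \<in> carrier ?F" for c
    by (rule free_module_hom_eq[OF assms(2) hom[OF assms(3)] hom[OF assms(4)]])
      (use that eq in \<open>simp_all add: pure_tensor_eq free_on_tuples_def\<close>)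
  then have "f X = f' X" if "X \<in> carrier (tensor_power R M n)" for X
    using that unfolding tensor_power_def by (metis quotient_moduleE)
  then show ?thesis
    using assms(3,4) by (auto simp: Hom_module_simps intro: extensionalityI)
qed

text \<open>
  The multilinear extension of a family \<open>v\<close> indexed by tuples of basis elements; it is linear in
  the first argument, with coefficients that are themselves multilinear in the others.
\<close>

fun ml_ext ::
  "('r, 'x) ring_scheme \<Rightarrow> ('r, 'p) module \<Rightarrow> ('s list \<Rightarrow> 'p) \<Rightarrow> ('s \<Rightarrow> 'r) list \<Rightarrow> 'p" where
  "ml_ext R P v [] = v []"
| "ml_ext R P v (x # xs) = lin_ext R P (\<lambda>s. ml_ext R P (\<lambda>ss. v (s # ss)) xs) x"

lemma ml_ext_closed:
  assumes "module R P" "v \<in> tuples S n \<rightarrow> carrier P" "xs \<in> tuples (carrier (free_module R S)) n"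
  shows "ml_ext R P v xs \<in> carrier P"
  using assms(2,3)
proof (induction xs arbitrary: n v)
  case Nil
  then show ?case by (auto simp: tuples_def)
next
  case (Cons x xs)
  then obtain m where m: "n = Suc m" "x \<in> carrier (free_module R S)"
    "xs \<in> tuples (carrier (free_module R S)) m" by (auto simp: tuples_def)
  have "ml_ext R P (\<lambda>ss. v (s # ss)) xs \<in> carrier P" if "s \<in> S" for s
    using Cons.prems that m by (intro Cons.IH[of _ m]) (auto simp: tuples_def Pi_iff)
  then show ?case
    using mod_hom_closed[OF lin_ext_hom[OF assms(1)] m(2)] by auto
qed

lemma multilinear_ml_ext:
  assumes "module R P" "v \<in> tuples S n \<rightarrow> carrier P"
  shows "multilinear R (free_module R S) P n (ml_ext R P v)"
proof -
  let ?F = "free_module R S"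
  have "(\<lambda>x. ml_ext R P v (us @ [x] @ vs)) \<in> mod_hom R ?F P"
    if "set us \<union> set vs \<subseteq> carrier ?F" "Suc (length us + length vs) = n"
       "v \<in> tuples S n \<rightarrow> carrier P" for us vs v n
    using that
  proof (induction us arbitrary: n v)
    case Nil
    have "ml_ext R P (\<lambda>ss. v (s # ss)) vs \<in> carrier P" if "s \<in> S" for s
      using Nil that
      by (intro ml_ext_closed[OF assms(1), of _ S "length vs"]) (auto simp: tuples_def Pi_iff)
    then show ?case by (auto intro!: lin_ext_hom[OF assms(1)])
  next
    case (Cons u us)
    then obtain m where m: "n = Suc m" by (cases n) auto
    have "(\<lambda>x. ml_ext R P (\<lambda>ss. v (s # ss)) (us @ [x] @ vs)) \<in> mod_hom R ?F P" if "s \<in> S" for s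
      using Cons.prems that m by (intro Cons.IH[of m]) (auto simp: tuples_def Pi_iff)
    then show ?case
      using mod_hom_lin_ext_family[OF assms(1), of u S
          "\<lambda>x s. ml_ext R P (\<lambda>ss. v (s # ss)) (us @ x # vs)"] Cons.prems by simp
  qed
  then show ?thesis
    unfolding multilinear_def using assms ml_ext_closed[OF assms] by blast
qed

lemma ml_ext_basis_elem:
  assumes "module R P" "v \<in> tuples S n \<rightarrow> carrier P" "ss \<in> tuples S n"
  shows "ml_ext R P v (map (basis_elem R) ss) = v ss"
  using assms(2,3)
proof (induction ss arbitrary: n v)
  case Nil
  then show ?case by simp
next
  case (Cons s ss)
  have R: "cring R" using assms(1) by (rule module.axioms)
  obtain m where m: "n = Suc m" "s \<in> S" "ss \<in> tuples S m"
    using Cons.prems by (auto simp: tuples_def)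
  have v: "(\<lambda>ss. v (t # ss)) \<in> tuples S m \<rightarrow> carrier P" if "t \<in> S" for t
    using Cons.prems that m by (auto simp: tuples_def Pi_iff)
  have "ml_ext R P (\<lambda>ss. v (t # ss)) (map (basis_elem R) ss) \<in> carrier P" if "t \<in> S" for t
    using m that v
    by (intro ml_ext_closed[OF assms(1), of _ S m]) (auto simp: tuples_def intro: basis_elem_closed[OF R])
  then have "ml_ext R P v (map (basis_elem R) (s # ss))
      = ml_ext R P (\<lambda>ss. v (s # ss)) (map (basis_elem R) ss)"
    using lin_ext_basis_elem[OF assms(1), of _ S s] m(2) by simp
  also have "\<dots> = v (s # ss)" using Cons.IH[OF v m(3)] m by blast
  finally show ?case .
qed

lemma multilinear_eq:
  assumes "module R P" "multilinear R (free_module R S) P n \<phi>" "multilinear R (free_module R S) P n \<psi>"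
    and eq: "\<And>ss. ss \<in> tuples S n \<Longrightarrow> \<phi> (map (basis_elem R) ss) = \<psi> (map (basis_elem R) ss)"
    and "xs \<in> tuples (carrier (free_module R S)) n"
  shows "\<phi> xs = \<psi> xs"
proof -
  have R: "cring R" using assms(1) by (rule module.axioms)
  \<comment> \<open>By induction on the part \<open>xs\<close> of the tuple that does not yet consist of basis elements.\<close>
  have "\<phi> (map (basis_elem R) gs @ xs) = \<psi> (map (basis_elem R) gs @ xs)"
    if "set gs \<subseteq> S" "set xs \<subseteq> carrier (free_module R S)" "length gs + length xs = n" for gs xs
    using that
  proof (induction xs arbitrary: gs)
    case Nil
    then show ?case using eq by (simp add: tuples_def)
  next
    case (Cons x xs)
    have gs: "set (map (basis_elem R) gs) \<subseteq> carrier (free_module R S)"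
      using Cons.prems by (auto intro: basis_elem_closed[OF R])
    show ?case
    proof (rule free_module_hom_eq[OF assms(1), where c = x])
      show "(\<lambda>x. \<phi> (map (basis_elem R) gs @ x # xs)) \<in> mod_hom R (free_module R S) P"
        "(\<lambda>x. \<psi> (map (basis_elem R) gs @ x # xs)) \<in> mod_hom R (free_module R S) P"
        using Cons.prems gs assms(2,3) by (auto intro!: multilinear_hom)
    next
      fix s assume "s \<in> S"
      then show "\<phi> (map (basis_elem R) gs @ basis_elem R s # xs)
          = \<psi> (map (basis_elem R) gs @ basis_elem R s # xs)"
        using Cons.IH[of "gs @ [s]"] Cons.prems by simp
    qed (use Cons.prems in auto)
  qed
  from this[of "[]" xs] show ?thesis using assms(5) by (simp add: tuples_def)
qed


section \<open>Cyclic faces of tuples of group elements\<close>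

text \<open>
  The face maps of the cyclic bar construction: the face of index \<open>i\<close> multiplies the entries of
  indices \<open>i\<close> and \<open>i + 1\<close>, and the last one multiplies the last entry with the first.
\<close>

definition cyclic_face :: "('g, 'y) monoid_scheme \<Rightarrow> nat \<Rightarrow> 'g list \<Rightarrow> 'g list" where
  "cyclic_face G i c = (if Suc i < length c then merge_at G (Suc i) c
    else (last c \<otimes>\<^bsub>G\<^esub> hd c) # butlast (tl c))"

lemma merge_at_Suc_0 [simp]: "merge_at G (Suc 0) (a # b # xs) = (a \<otimes>\<^bsub>G\<^esub> b) # xs"
  by (simp add: merge_at_def)

lemma merge_at_Suc_Suc [simp]: "merge_at G (Suc (Suc i)) (a # xs) = a # merge_at G (Suc i) xs"
  by (simp add: merge_at_def)

lemma length_merge_at: "1 \<le> i \<Longrightarrow> i < length c \<Longrightarrow> length (merge_at G i c) = length c - 1"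
  by (simp add: merge_at_def)

lemma (in monoid) merge_at_tuples:
  assumes "c \<in> tuples (carrier G) (Suc n)" "1 \<le> i" "i \<le> n"
  shows "merge_at G i c \<in> tuples (carrier G) n"
proof -
  have "c ! (i - 1) \<in> set c" "c ! i \<in> set c" using assms by (auto simp: tuples_def)
  moreover have "set c \<subseteq> carrier G" using assms(1) by (simp add: tuples_def)
  ultimately have "c ! (i - 1) \<otimes>\<^bsub>G\<^esub> c ! i \<in> carrier G" by (intro m_closed) blast+
  then show ?thesis
    using assms set_take_subset[of "i - 1" c] set_drop_subset[of "i + 1" c]
    by (auto simp: tuples_def length_merge_at) (auto simp: merge_at_def)
qed

lemma (in monoid) cyclic_face_tuples:
  assumes "c \<in> tuples (carrier G) (Suc (Suc n))"
  shows "cyclic_face G i c \<in> tuples (carrier G) (Suc n)"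
proof (cases "Suc i < length c")
  case True
  then show ?thesis
    using merge_at_tuples[OF assms, of "Suc i"] assms by (simp add: cyclic_face_def tuples_def)
next
  case False
  from assms obtain a cs where c: "c = a # cs" "a \<in> carrier G" "length cs = Suc n"
      "set cs \<subseteq> carrier G"
    by (cases c) (auto simp: tuples_def)
  moreover from c have "last cs \<in> set cs" by (intro last_in_set) auto
  ultimately have "last cs \<in> carrier G" "set (butlast cs) \<subseteq> carrier G"
    by (blast, auto dest: in_set_butlastD)
  then show ?thesis using False c by (auto simp: cyclic_face_def tuples_def)
qed

lemma (in monoid) group_prod_closed: "set xs \<subseteq> carrier G \<Longrightarrow> group_prod G xs \<in> carrier G"
  by (induction xs) (auto simp: group_prod_def)

lemma group_prod_Nil [simp]: "group_prod G [] = \<one>\<^bsub>G\<^esub>"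
  and group_prod_Cons [simp]: "group_prod G (x # xs) = x \<otimes>\<^bsub>G\<^esub> group_prod G xs"
  by (simp_all add: group_prod_def)

lemma (in monoid) group_prod_append:
  "set xs \<subseteq> carrier G \<Longrightarrow> set ys \<subseteq> carrier G
    \<Longrightarrow> group_prod G (xs @ ys) = group_prod G xs \<otimes> group_prod G ys"
  by (induction xs) (auto simp: m_assoc group_prod_closed)

lemma (in monoid) group_prod_merge_at:
  "set c \<subseteq> carrier G \<Longrightarrow> Suc i < length c \<Longrightarrow> group_prod G (merge_at G (Suc i) c) = group_prod G c"
proof (induction i arbitrary: c)
  case 0
  then obtain a b xs where "c = a # b # xs" by (cases c; cases "tl c") auto
  then show ?case using 0 by (simp add: m_assoc group_prod_closed)
next
  case (Suc i)
  then obtain a xs where "c = a # xs" by (cases c) auto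
  then show ?case using Suc by simp
qed

text \<open>Cyclic faces preserve the conjugacy class of the product, in particular its triviality.\<close>

lemma (in group) group_prod_cyclic_face:
  assumes "c \<in> tuples (carrier G) (Suc (Suc n))"
  shows "group_prod G (cyclic_face G i c) = \<one> \<longleftrightarrow> group_prod G c = \<one>"
proof (cases "Suc i < length c")
  case True
  then show ?thesis
    using group_prod_merge_at[of c i] assms by (simp add: cyclic_face_def tuples_def)
next
  case False
  from assms obtain a cs where c: "c = a # cs" "length cs = Suc n" "a \<in> carrier G" "set cs \<subseteq> carrier G"
    by (cases c) (auto simp: tuples_def)
  then obtain ms b where cs: "cs = ms @ [b]" by (cases cs rule: rev_cases) auto
  have G: "b \<in> carrier G" "set ms \<subseteq> carrier G" using c cs by auto
  note P = group_prod_closed[OF G(2)]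
  have "group_prod G c = (a \<otimes> group_prod G ms) \<otimes> b"
    using c cs G P by (simp add: group_prod_append m_assoc)
  moreover have "group_prod G (cyclic_face G i c) = b \<otimes> (a \<otimes> group_prod G ms)"
    using c cs G P False by (simp add: cyclic_face_def m_assoc)
  ultimately show ?thesis
    using inv_comm[of b "a \<otimes> group_prod G ms"] inv_comm[of "a \<otimes> group_prod G ms" b] c(3) G P by auto
qed

lemma (in monoid) merge_at_merge_at:
  "set c \<subseteq> carrier G \<Longrightarrow> i < j \<Longrightarrow> Suc j < length c \<Longrightarrow>
    merge_at G (Suc i) (merge_at G (Suc j) c) = merge_at G j (merge_at G (Suc i) c)"
proof (induction i arbitrary: c j)
  case 0
  then obtain a b d xs where c: "c = a # b # d # xs"
    by (cases c; cases "tl c"; cases "tl (tl c)") auto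
  obtain j' where j: "j = Suc j'" using 0 by (cases j) auto
  show ?case
  proof (cases j')
    case 0
    then show ?thesis using \<open>set c \<subseteq> carrier G\<close> by (simp add: c j m_assoc)
  next
    case (Suc j'')
    then show ?thesis by (simp add: c j)
  qed
next
  case (Suc i)
  then obtain a xs where c: "c = a # xs" by (cases c) auto
  obtain j' where j: "j = Suc j'" "i < j'" using Suc.prems by (cases j) auto
  then obtain j'' where j': "j' = Suc j''" by (cases j') auto
  show ?case using Suc.IH[of xs j'] Suc.prems c j j' by simp
qed

lemma last_merge_at: "Suc (Suc i) < length c \<Longrightarrow> last (merge_at G (Suc i) c) = last c"
  by (simp add: merge_at_def)

lemma butlast_merge_at:
  "Suc (Suc i) < length c \<Longrightarrow> butlast (merge_at G (Suc i) c) = merge_at G (Suc i) (butlast c)"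
  by (simp add: merge_at_def butlast_append nth_butlast take_butlast drop_butlast)

lemma merge_at_last:
  "merge_at G (Suc (length xs)) (xs @ [a, b]) = xs @ [a \<otimes>\<^bsub>G\<^esub> b]"
  by (simp add: merge_at_def nth_append)

text \<open>The simplicial identity. 
  The simplicial identity. Tuples of length two are excluded: their faces have a single entry, on
  which the face maps have no meaning.
\<close>

lemma (in monoid) cyclic_face_cyclic_face:
  assumes c: "set c \<subseteq> carrier G" "3 \<le> length c" and ij: "i < j" "j < length c"
  shows "cyclic_face G i (cyclic_face G j c) = cyclic_face G (j - 1) (cyclic_face G i c)"
proof (cases "Suc j < length c")
  case True
  then show ?thesis
    using merge_at_merge_at[OF c(1) ij(1) True] ij less_diff_conv[of j "length c" 1]
    by (simp add: cyclic_face_def length_merge_at)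
next
  case False
  obtain a cs where c1: "c = a # cs" using c by (cases c) auto
  obtain cs' z where c2: "cs = cs' @ [z]" using c c1 by (cases cs rule: rev_cases) auto
  obtain ms y where c3: "cs' = ms @ [y]" using c c1 c2 by (cases cs' rule: rev_cases) auto
  note ceq = c1 c2 c3
  have G: "a \<in> carrier G" "y \<in> carrier G" "z \<in> carrier G" "set ms \<subseteq> carrier G"
    using c(1) ceq by auto
  have j: "j = Suc (Suc (length ms))" using False ij ceq by simp
  have fj: "cyclic_face G j c = (z \<otimes> a) # ms @ [y]"
    using j ceq by (simp add: cyclic_face_def butlast_append)
  consider (first) "i = 0" | (mid) i' where "i = Suc i'" "i' < length ms" | (last) "i = Suc (length ms)"
    using ij j by (cases i) (auto simp: less_Suc_eq)
  then show ?thesis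
  proof cases
    case first
    then show ?thesis
    proof (cases ms)
      case Nil
      then show ?thesis using first G
        by (simp add: fj) (simp add: cyclic_face_def ceq j m_assoc)
    next
      case (Cons b bs)
      then show ?thesis using first G
        by (simp add: fj) (simp add: cyclic_face_def ceq j m_assoc butlast_append)
    qed
  next
    case mid
    have "cyclic_face G i (cyclic_face G j c) = (z \<otimes> a) # merge_at G (Suc i') (ms @ [y])"
      using mid unfolding fj by (simp add: cyclic_face_def)
    moreover have "cyclic_face G i c = a # merge_at G (Suc i') ((ms @ [y]) @ [z])"
      using mid ceq by (simp add: cyclic_face_def)
    moreover have "last (merge_at G (Suc i') ((ms @ [y]) @ [z])) = z"
      "butlast (merge_at G (Suc i') ((ms @ [y]) @ [z])) = merge_at G (Suc i') (ms @ [y])"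
      "length (merge_at G (Suc i') ((ms @ [y]) @ [z])) = Suc (length ms)"
      using mid by (simp_all add: last_merge_at butlast_merge_at length_merge_at butlast_append)
    ultimately show ?thesis using j
      by (auto simp: cyclic_face_def simp del: append_assoc)
  next
    case last
    have "cyclic_face G i (cyclic_face G j c) = (y \<otimes> (z \<otimes> a)) # ms"
      using last unfolding fj by (simp add: cyclic_face_def)
    moreover have "cyclic_face G i c = a # ms @ [y \<otimes> z]"
      using last ceq merge_at_last[of G ms y z] by (simp add: cyclic_face_def)
    ultimately show ?thesis using j G by (simp add: cyclic_face_def m_assoc)
  qed
qed


text \<open>
  The cancellation behind the vanishing of the square of the differential of a cosimplicial object.
  In passing from \<open>m\<close> to \<open>m + 1\<close> the new row \<open>j = m + 2\<close> and the new column \<open>i = m + 1\<close> cancel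
  each other.
\<close>

lemma (in abelian_group) finsum_simplicial_cancel:
  fixes t :: "nat \<Rightarrow> nat \<Rightarrow> 'a"
  assumes "\<And>j i. t j i \<in> carrier G"
    and "\<And>j i. i < j \<Longrightarrow> j \<le> Suc m \<Longrightarrow> t j i = \<ominus> t i (j - 1)"
  shows "(\<Oplus>j\<in>{..Suc m}. \<Oplus>i\<in>{..m}. t j i) = \<zero>"
  using assms(2)
proof (induction m)
  case 0
  have "t (Suc 0) 0 = \<ominus> t 0 0" using 0[of 0 "Suc 0"] by simp
  then show ?case using assms(1) by (simp add: l_neg)
next
  case (Suc m)
  have IH: "(\<Oplus>j\<in>{..Suc m}. \<Oplus>i\<in>{..m}. t j i) = \<zero>" using Suc by simp
  have last: "(\<Oplus>i\<in>{..Suc m}. t (Suc (Suc m)) i) = (\<Oplus>i\<in>{..Suc m}. \<ominus> t i (Suc m))"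
    using Suc.prems assms(1) by (intro finsum_cong') auto
  have "(\<Oplus>j\<in>{..Suc m}. \<Oplus>i\<in>{..Suc m}. t j i)
      = (\<Oplus>j\<in>{..Suc m}. t j (Suc m) \<oplus> (\<Oplus>i\<in>{..m}. t j i))"
    using assms(1) by (intro finsum_cong') auto
  also have "\<dots> = (\<Oplus>j\<in>{..Suc m}. t j (Suc m)) \<oplus> (\<Oplus>j\<in>{..Suc m}. \<Oplus>i\<in>{..m}. t j i)"
    using assms(1) by (intro finsum_addf) auto
  finally have rest: "(\<Oplus>j\<in>{..Suc m}. \<Oplus>i\<in>{..Suc m}. t j i) = (\<Oplus>j\<in>{..Suc m}. t j (Suc m))"
    using IH assms(1) by simp
  have "(\<Oplus>j\<in>{..Suc (Suc m)}. \<Oplus>i\<in>{..Suc m}. t j i)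
      = (\<Oplus>i\<in>{..Suc m}. t (Suc (Suc m)) i) \<oplus> (\<Oplus>j\<in>{..Suc m}. \<Oplus>i\<in>{..Suc m}. t j i)"
    using assms(1) by (intro finsum_Suc) auto
  also have "\<dots> = (\<Oplus>i\<in>{..Suc m}. \<ominus> t i (Suc m)) \<oplus> (\<Oplus>j\<in>{..Suc m}. t j (Suc m))"
    by (simp only: last rest)
  also have "\<dots> = (\<Oplus>i\<in>{..Suc m}. \<ominus> t i (Suc m) \<oplus> t i (Suc m))"
    using assms(1) by (intro finsum_addf[symmetric]) auto
  also have "\<dots> = (\<Oplus>i\<in>{..Suc m}. \<zero>)"
    using assms(1) by (intro finsum_cong') (auto simp: l_neg)
  finally show ?case by simp
qed


section \<open>The group ring\<close>

lemma group_ring_simps: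
  "carrier (group_ring R G) = carrier (free_module R (carrier G))"
  "\<zero>\<^bsub>group_ring R G\<^esub> = (\<lambda>s. \<zero>\<^bsub>R\<^esub>)"
  "a \<oplus>\<^bsub>group_ring R G\<^esub> b = (\<lambda>s. a s \<oplus>\<^bsub>R\<^esub> b s)"
  "r \<odot>\<^bsub>group_ring R G\<^esub> a = (\<lambda>s. r \<otimes>\<^bsub>R\<^esub> a s)"
  by (simp_all add: group_ring_def free_module_def)

lemma module_group_ring:
  assumes "cring R"
  shows "module R (group_ring R G)"
  using module_free_module[OF assms, of "carrier G"]
  unfolding module_def abelian_group_def abelian_monoid_def abelian_group_axioms_def
    module_axioms_def group_ring_def
  by simp

lemma multilinear_group_ring:
  "multilinear R (group_ring R G) P n \<phi> \<longleftrightarrow> multilinear R (free_module R (carrier G)) P n \<phi>"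
  by (simp add: multilinear_def mod_hom_def group_ring_def)

text \<open>
  A commutative ring of coefficients and a group. \<open>K\<close> is the group ring, \<open>H n\<close> the module of
  Hochschild cochains of degree \<open>n\<close>, and \<open>sign i\<close> is \<open>(- 1)\<^sup>i\<close> in \<open>k\<close>.
\<close>

locale group_ring_data = k: cring k + G: group G
  for k :: "('r, 'x) ring_scheme" and G :: "('g, 'y) monoid_scheme"
begin

abbreviation "K \<equiv> group_ring k G"
abbreviation "H \<equiv> hochschild_module k G"
abbreviation "\<delta> \<equiv> hochschild_differential k G"
abbreviation "sign i \<equiv> (\<ominus>\<^bsub>k\<^esub> \<one>\<^bsub>k\<^esub>) [^]\<^bsub>k\<^esub> (i :: nat)"

lemma module_K: "module k K"
  by (rule module_group_ring) (rule k.is_cring)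

lemma K_coeff_closed: "a \<in> carrier K \<Longrightarrow> a h \<in> carrier k"
  by (simp add: group_ring_simps free_module_simps)

lemma K_coeff_outside: "a \<in> carrier K \<Longrightarrow> h \<notin> carrier G \<Longrightarrow> a h = \<zero>\<^bsub>k\<^esub>"
  by (simp add: group_ring_simps free_module_simps)

lemma finsum_K_coeff:
  assumes "finite A" "F \<in> A \<rightarrow> carrier K"
  shows "finsum K F A h = (\<Oplus>\<^bsub>k\<^esub>i\<in>A. F i h)"
proof -
  interpret K: module k K by (rule module_K)
  show ?thesis using assms
  proof (induction A rule: finite_induct)
    case empty
    then show ?case by (simp add: group_ring_simps)
  next
    case (insert x A)
    then have "F x \<in> carrier K" "F \<in> A \<rightarrow> carrier K" by auto
    moreover from this have "(\<lambda>i. F i h) \<in> A \<rightarrow> carrier k" using K_coeff_closed by blast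
    ultimately show ?case
      using insert by (simp add: K_coeff_closed group_ring_simps(3))
  qed
qed

lemma sign_closed [simp]: "sign i \<in> carrier k"
  by simp

lemma sign_Suc: "sign (Suc i) = \<ominus>\<^bsub>k\<^esub> sign i"
  by (simp add: k.r_minus)

lemma K_mult_coeff:
  "(a \<otimes>\<^bsub>K\<^esub> b) x = finsum k (\<lambda>(h, h'). a h \<otimes>\<^bsub>k\<^esub> b h')
     {(h, h'). a h \<noteq> \<zero>\<^bsub>k\<^esub> \<and> b h' \<noteq> \<zero>\<^bsub>k\<^esub> \<and> h \<otimes>\<^bsub>G\<^esub> h' = x}"
  by (simp add: group_ring_def)

text \<open>Multiplication by a group element translates the coefficients.\<close>

lemma basis_mult_coeff:
  assumes g: "g \<in> carrier G" and a: "a \<in> carrier K"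
  shows "(basis_elem k g \<otimes>\<^bsub>K\<^esub> a) x = (if x \<in> carrier G then a (inv\<^bsub>G\<^esub> g \<otimes>\<^bsub>G\<^esub> x) else \<zero>\<^bsub>k\<^esub>)"
proof -
  let ?y = "inv\<^bsub>G\<^esub> g \<otimes>\<^bsub>G\<^esub> x"
  let ?S = "{(h, h'). basis_elem k g h \<noteq> \<zero>\<^bsub>k\<^esub> \<and> a h' \<noteq> \<zero>\<^bsub>k\<^esub> \<and> h \<otimes>\<^bsub>G\<^esub> h' = x}"
  have S: "?S \<subseteq> (if x \<in> carrier G then {(g, ?y)} else {})"
  proof (clarify)
    fix h h' assume *: "basis_elem k g h \<noteq> \<zero>\<^bsub>k\<^esub>" "a h' \<noteq> \<zero>\<^bsub>k\<^esub>" "x = h \<otimes>\<^bsub>G\<^esub> h'"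
    then have "h = g" "h' \<in> carrier G"
      using K_coeff_outside[OF a] by (auto simp: basis_elem_def split: if_splits)
    then show "(h, h') \<in> (if h \<otimes>\<^bsub>G\<^esub> h' \<in> carrier G then {(g, inv\<^bsub>G\<^esub> g \<otimes>\<^bsub>G\<^esub> (h \<otimes>\<^bsub>G\<^esub> h'))} else {})"
      using g by (simp add: G.m_assoc[symmetric])
  qed
  show ?thesis
  proof (cases "(g, ?y) \<in> ?S \<and> x \<in> carrier G")
    case True
    then have "?S = {(g, ?y)}" using S by auto
    then show ?thesis using True a
      by (simp add: K_mult_coeff K_coeff_closed basis_elem_def)
  next
    case False
    then have e: "?S = {}" using S by (auto split: if_splits)
    have "a ?y = \<zero>\<^bsub>k\<^esub>" if x: "x \<in> carrier G"
    proof -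
      have "g \<otimes>\<^bsub>G\<^esub> ?y = x" using g x by (simp add: G.m_assoc[symmetric])
      \<comment> \<open>In the zero ring the basis element itself is zero, and so is every coefficient.\<close>
      then have "\<one>\<^bsub>k\<^esub> = \<zero>\<^bsub>k\<^esub> \<or> a ?y = \<zero>\<^bsub>k\<^esub>" using False x by (auto simp: basis_elem_def)
      then show ?thesis using K_coeff_closed[OF a] k.l_null k.l_one by metis
    qed
    then show ?thesis unfolding K_mult_coeff e by simp
  qed
qed

lemma mult_basis_coeff:
  assumes g: "g \<in> carrier G" and a: "a \<in> carrier K"
  shows "(a \<otimes>\<^bsub>K\<^esub> basis_elem k g) x = (if x \<in> carrier G then a (x \<otimes>\<^bsub>G\<^esub> inv\<^bsub>G\<^esub> g) else \<zero>\<^bsub>k\<^esub>)"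
proof -
  let ?y = "x \<otimes>\<^bsub>G\<^esub> inv\<^bsub>G\<^esub> g"
  let ?S = "{(h, h'). a h \<noteq> \<zero>\<^bsub>k\<^esub> \<and> basis_elem k g h' \<noteq> \<zero>\<^bsub>k\<^esub> \<and> h \<otimes>\<^bsub>G\<^esub> h' = x}"
  have S: "?S \<subseteq> (if x \<in> carrier G then {(?y, g)} else {})"
  proof (clarify)
    fix h h' assume *: "a h \<noteq> \<zero>\<^bsub>k\<^esub>" "basis_elem k g h' \<noteq> \<zero>\<^bsub>k\<^esub>" "x = h \<otimes>\<^bsub>G\<^esub> h'"
    then have "h' = g" "h \<in> carrier G"
      using K_coeff_outside[OF a] by (auto simp: basis_elem_def split: if_splits)
    then show "(h, h') \<in> (if h \<otimes>\<^bsub>G\<^esub> h' \<in> carrier G then {(h \<otimes>\<^bsub>G\<^esub> h' \<otimes>\<^bsub>G\<^esub> inv\<^bsub>G\<^esub> g, g)} else {})"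
      using g by (simp add: G.m_assoc)
  qed
  show ?thesis
  proof (cases "(?y, g) \<in> ?S \<and> x \<in> carrier G")
    case True
    then have "?S = {(?y, g)}" using S by auto
    then show ?thesis using True a
      by (simp add: K_mult_coeff K_coeff_closed basis_elem_def)
  next
    case False
    then have e: "?S = {}" using S by (auto split: if_splits)
    have "a ?y = \<zero>\<^bsub>k\<^esub>" if x: "x \<in> carrier G"
    proof -
      have "?y \<otimes>\<^bsub>G\<^esub> g = x" using g x by (simp add: G.m_assoc)
      \<comment> \<open>In the zero ring the basis element itself is zero, and so is every coefficient.\<close>
      then have "\<one>\<^bsub>k\<^esub> = \<zero>\<^bsub>k\<^esub> \<or> a ?y = \<zero>\<^bsub>k\<^esub>" using False x by (auto simp: basis_elem_def)
      then show ?thesis using K_coeff_closed[OF a] k.l_null k.l_one by metis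
    qed
    then show ?thesis unfolding K_mult_coeff e by simp
  qed
qed

text \<open>Reindexing the coefficients injectively preserves finite support.\<close>

lemma K_closedI:
  assumes a: "a \<in> carrier K" and "inj_on \<sigma> (carrier G)"
    and b: "\<And>x. b x = (if x \<in> carrier G then a (\<sigma> x) else \<zero>\<^bsub>k\<^esub>)"
  shows "b \<in> carrier K"
proof -
  have "finite ({x. a x \<noteq> \<zero>\<^bsub>k\<^esub>})" using a by (simp add: group_ring_simps free_module_simps)
  then have "finite (\<sigma> -` {x. a x \<noteq> \<zero>\<^bsub>k\<^esub>} \<inter> carrier G)"
    using assms(2) by (rule finite_vimage_IntI)
  then have "finite {x. b x \<noteq> \<zero>\<^bsub>k\<^esub>}"
    by (rule rev_finite_subset) (auto simp: b split: if_splits)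
  then show ?thesis using a K_coeff_closed[OF a]
    by (auto simp: group_ring_simps free_module_simps b)
qed

lemma basis_mult_closed:
  assumes "g \<in> carrier G" "a \<in> carrier K"
  shows "basis_elem k g \<otimes>\<^bsub>K\<^esub> a \<in> carrier K"
  by (rule K_closedI[OF assms(2), where \<sigma> = "\<lambda>x. inv\<^bsub>G\<^esub> g \<otimes>\<^bsub>G\<^esub> x"])
    (use assms in \<open>auto simp: basis_mult_coeff inj_on_def\<close>)

lemma mult_basis_closed:
  assumes "g \<in> carrier G" "a \<in> carrier K"
  shows "a \<otimes>\<^bsub>K\<^esub> basis_elem k g \<in> carrier K"
  by (rule K_closedI[OF assms(2), where \<sigma> = "\<lambda>x. x \<otimes>\<^bsub>G\<^esub> inv\<^bsub>G\<^esub> g"])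
    (use assms in \<open>auto simp: mult_basis_coeff inj_on_def\<close>)


section \<open>Cochains and their values on group elements\<close>

lemma module_H: "module k (H n)"
  unfolding hochschild_module_def
  by (rule module_Hom_module[OF module_K tensor_power_closed[OF module_K]])

lemma map_basis_tuples: "gs \<in> tuples (carrier G) n \<Longrightarrow> map (basis_elem k) gs \<in> tuples (carrier K) n"
  by (auto simp: tuples_def group_ring_simps(1) intro!: basis_elem_closed k.is_cring)

lemma group_tensor_closed:
  "gs \<in> tuples (carrier G) n \<Longrightarrow> group_tensor k G gs \<in> carrier (tensor_power k K n)"
  unfolding group_tensor_def by (rule pure_tensor_closed[OF module_K map_basis_tuples])

lemma cochain_value_closed:
  "f \<in> carrier (H n) \<Longrightarrow> gs \<in> tuples (carrier G) n \<Longrightarrow> f (group_tensor k G gs) \<in> carrier K"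
  unfolding hochschild_module_def Hom_module_simps
  by (blast intro: mod_hom_closed group_tensor_closed)

lemma cochain_add_value:
  "gs \<in> tuples (carrier G) n \<Longrightarrow> (f \<oplus>\<^bsub>H n\<^esub> f') (group_tensor k G gs)
    = f (group_tensor k G gs) \<oplus>\<^bsub>K\<^esub> f' (group_tensor k G gs)"
  by (simp add: hochschild_module_def Hom_module_simps group_tensor_closed)

lemma cochain_smult_value:
  "gs \<in> tuples (carrier G) n \<Longrightarrow> (r \<odot>\<^bsub>H n\<^esub> f) (group_tensor k G gs)
    = r \<odot>\<^bsub>K\<^esub> f (group_tensor k G gs)"
  by (simp add: hochschild_module_def Hom_module_simps group_tensor_closed)

lemma cochain_zero_value:
  "gs \<in> tuples (carrier G) n \<Longrightarrow> \<zero>\<^bsub>H n\<^esub> (group_tensor k G gs) = \<zero>\<^bsub>K\<^esub>"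
  by (simp add: hochschild_module_def Hom_module_simps group_tensor_closed)

lemma cochain_eq_if_values_eq:
  assumes "f \<in> carrier (H n)" "f' \<in> carrier (H n)"
    and "\<And>gs. gs \<in> tuples (carrier G) n \<Longrightarrow> f (group_tensor k G gs) = f' (group_tensor k G gs)"
  shows "f = f'"
proof -
  have ml: "multilinear k (free_module k (carrier G)) K n (\<lambda>xs. h (pure_tensor k K xs))"
    if "h \<in> carrier (H n)" for h
    using multilinear_pure_tensor[OF module_K module_K, of h n] that
    by (simp add: hochschild_module_def Hom_module_simps multilinear_group_ring)
  show ?thesis
  proof (rule tensor_power_hom_eq[OF module_K module_K])
    fix xs assume "xs \<in> tuples (carrier K) n"
    then have xs: "xs \<in> tuples (carrier (free_module k (carrier G))) n"
      by (simp only: group_ring_simps(1))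
    show "f (pure_tensor k K xs) = f' (pure_tensor k K xs)"
      by (rule multilinear_eq[OF module_K ml[OF assms(1)] ml[OF assms(2)] _ xs])
        (rule assms(3)[unfolded group_tensor_def])
  qed (use assms(1,2) in \<open>simp_all only: hochschild_module_def\<close>)
qed

lemma cochain_with_values:
  assumes "v \<in> tuples (carrier G) n \<rightarrow> carrier K"
  shows cochain_with_values_closed: "cochain_with_values k G n v \<in> carrier (H n)"
    and cochain_with_values_value: "gs \<in> tuples (carrier G) n
      \<Longrightarrow> cochain_with_values k G n v (group_tensor k G gs) = v gs"
proof -
  have "multilinear k K K n (ml_ext k K v)"
    unfolding multilinear_group_ring by (rule multilinear_ml_ext[OF module_K assms])
  then obtain f where "f \<in> carrier (H n)"
      "\<And>xs. xs \<in> tuples (carrier K) n \<Longrightarrow> f (pure_tensor k K xs) = ml_ext k K v xs"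
    using tensor_power_lift[OF module_K module_K] unfolding hochschild_module_def by metis
  then have f: "f \<in> carrier (H n) \<and> (\<forall>gs\<in>tuples (carrier G) n. f (group_tensor k G gs) = v gs)"
    using ml_ext_basis_elem[OF module_K assms] map_basis_tuples by (simp add: group_tensor_def)
  then have "cochain_with_values k G n v \<in> carrier (H n) \<and>
      (\<forall>gs\<in>tuples (carrier G) n. cochain_with_values k G n v (group_tensor k G gs) = v gs)"
    unfolding cochain_with_values_def
  proof (rule theI[where P = "\<lambda>f. f \<in> carrier (H n) \<and>
        (\<forall>gs\<in>tuples (carrier G) n. f (group_tensor k G gs) = v gs)"])
    fix f' assume "f' \<in> carrier (H n) \<and> (\<forall>gs\<in>tuples (carrier G) n. f' (group_tensor k G gs) = v gs)"
    then show "f' = f" using f by (intro cochain_eq_if_values_eq[of f' n f]) simp_all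
  qed
  then show "cochain_with_values k G n v \<in> carrier (H n)"
    "gs \<in> tuples (carrier G) n \<Longrightarrow> cochain_with_values k G n v (group_tensor k G gs) = v gs"
    by auto
qed


section \<open>The Hochschild complex in cyclic coordinates\<close>

text \<open>
  The cyclic coordinates of a cochain of degree \<open>n\<close>: at the tuple \<open>(g\<^sub>0, g\<^sub>1, \<dots>, g\<^sub>n)\<close> they record
  the coefficient of \<open>g\<^sub>0\<^sup>-\<^sup>1\<close> in \<open>f(g\<^sub>1 \<otimes> \<dots> \<otimes> g\<^sub>n)\<close>. With the inverse, the product
  \<open>g\<^sub>0 g\<^sub>1 \<dots> g\<^sub>n\<close> is trivial exactly for the coefficient of \<open>g\<^sub>1 \<dots> g\<^sub>n\<close>.
\<close>

definition cyclic_coeff :: "('r, 'g) hochschild_cochain \<Rightarrow> 'g list \<Rightarrow> 'r" where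
  "cyclic_coeff f c = f (group_tensor k G (tl c)) (inv\<^bsub>G\<^esub> (hd c))"

lemma cyclic_coeff_closed:
  "f \<in> carrier (H n) \<Longrightarrow> c \<in> tuples (carrier G) (Suc n) \<Longrightarrow> cyclic_coeff f c \<in> carrier k"
  unfolding cyclic_coeff_def
  by (rule K_coeff_closed[OF cochain_value_closed]) (cases c; auto simp: tuples_def)+

lemma tl_tuples: "c \<in> tuples (carrier G) (Suc n) \<Longrightarrow> tl c \<in> tuples (carrier G) n"
  by (cases c) (auto simp: tuples_def)

lemma cyclic_coeff_add:
  "c \<in> tuples (carrier G) (Suc n) \<Longrightarrow>
    cyclic_coeff (f \<oplus>\<^bsub>H n\<^esub> f') c = cyclic_coeff f c \<oplus>\<^bsub>k\<^esub> cyclic_coeff f' c"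
  by (simp add: cyclic_coeff_def cochain_add_value tl_tuples group_ring_simps(3))

lemma cyclic_coeff_smult:
  "c \<in> tuples (carrier G) (Suc n) \<Longrightarrow> cyclic_coeff (r \<odot>\<^bsub>H n\<^esub> f) c = r \<otimes>\<^bsub>k\<^esub> cyclic_coeff f c"
  by (simp add: cyclic_coeff_def cochain_smult_value tl_tuples group_ring_simps(4))

lemma cyclic_coeff_zero:
  "c \<in> tuples (carrier G) (Suc n) \<Longrightarrow> cyclic_coeff \<zero>\<^bsub>H n\<^esub> c = \<zero>\<^bsub>k\<^esub>"
  by (simp add: cyclic_coeff_def cochain_zero_value tl_tuples group_ring_simps(2))

lemma value_eq_cyclic_coeff:
  "h \<in> carrier G \<Longrightarrow> f (group_tensor k G gs) h = cyclic_coeff f (inv\<^bsub>G\<^esub> h # gs)"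
  by (simp add: cyclic_coeff_def)

lemma Cons_tuples:
  "h \<in> carrier G \<Longrightarrow> gs \<in> tuples (carrier G) n \<Longrightarrow> h # gs \<in> tuples (carrier G) (Suc n)"
  by (simp add: tuples_def)

lemma cochain_eqI:
  assumes "f \<in> carrier (H n)" "f' \<in> carrier (H n)"
    and "\<And>c. c \<in> tuples (carrier G) (Suc n) \<Longrightarrow> cyclic_coeff f c = cyclic_coeff f' c"
  shows "f = f'"
proof (rule cochain_eq_if_values_eq[OF assms(1,2)])
  fix gs assume gs: "gs \<in> tuples (carrier G) n"
  show "f (group_tensor k G gs) = f' (group_tensor k G gs)"
  proof
    fix h
    show "f (group_tensor k G gs) h = f' (group_tensor k G gs) h"
    proof (cases "h \<in> carrier G")
      case True
      then show ?thesis
        using assms(3)[of "inv\<^bsub>G\<^esub> h # gs"] gs by (simp add: value_eq_cyclic_coeff Cons_tuples)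
    next
      case False
      then show ?thesis
        using K_coeff_outside[OF cochain_value_closed[OF assms(1) gs] False]
          K_coeff_outside[OF cochain_value_closed[OF assms(2) gs] False]
        by simp
    qed
  qed
qed

lemma cochain_of_cyclic_coeff_exists:
  assumes "\<And>gs. gs \<in> tuples (carrier G) n \<Longrightarrow>
    (\<lambda>h. if h \<in> carrier G then \<phi> (inv\<^bsub>G\<^esub> h # gs) else \<zero>\<^bsub>k\<^esub>) \<in> carrier K"
  obtains f where "f \<in> carrier (H n)"
    "\<And>c. c \<in> tuples (carrier G) (Suc n) \<Longrightarrow> cyclic_coeff f c = \<phi> c"
proof -
  let ?v = "\<lambda>gs h. if h \<in> carrier G then \<phi> (inv\<^bsub>G\<^esub> h # gs) else \<zero>\<^bsub>k\<^esub>"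
  have v: "?v \<in> tuples (carrier G) n \<rightarrow> carrier K" using assms by blast
  have "cyclic_coeff (cochain_with_values k G n ?v) c = \<phi> c" if c: "c \<in> tuples (carrier G) (Suc n)" for c
  proof -
    have "hd c \<in> carrier G" "c = hd c # tl c" using c by (cases c; auto simp: tuples_def)+
    then show ?thesis
      unfolding cyclic_coeff_def cochain_with_values_value[OF v tl_tuples[OF c]] by simp
  qed
  then show ?thesis using that cochain_with_values_closed[OF v] by blast
qed

lemma differential_values_closed:
  assumes f: "f \<in> carrier (H n)" and gs: "gs \<in> tuples (carrier G) (Suc n)"
  shows "basis_elem k (hd gs) \<otimes>\<^bsub>K\<^esub> f (group_tensor k G (tl gs)) \<in> carrier K"
    and "i \<in> {1..n} \<Longrightarrow> sign i \<odot>\<^bsub>K\<^esub> f (group_tensor k G (merge_at G i gs)) \<in> carrier K"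
    and "f (group_tensor k G (butlast gs)) \<otimes>\<^bsub>K\<^esub> basis_elem k (last gs) \<in> carrier K"
proof -
  interpret K: module k K by (rule module_K)
  have ends: "hd gs \<in> carrier G" "last gs \<in> carrier G" "butlast gs \<in> tuples (carrier G) n"
    using gs by (auto simp: tuples_def dest: in_set_butlastD) (cases gs; force)+
  note val = cochain_value_closed[OF f]
  show "basis_elem k (hd gs) \<otimes>\<^bsub>K\<^esub> f (group_tensor k G (tl gs)) \<in> carrier K"
    by (rule basis_mult_closed[OF ends(1) val[OF tl_tuples[OF gs]]])
  show "sign i \<odot>\<^bsub>K\<^esub> f (group_tensor k G (merge_at G i gs)) \<in> carrier K" if "i \<in> {1..n}"
    using that by (intro K.smult_closed val G.merge_at_tuples[OF gs]) auto
  show "f (group_tensor k G (butlast gs)) \<otimes>\<^bsub>K\<^esub> basis_elem k (last gs) \<in> carrier K"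
    by (rule mult_basis_closed[OF ends(2) val[OF ends(3)]])
qed

lemma differential_with_values:
  assumes f: "f \<in> carrier (H n)"
  shows differential_closed: "\<delta> n f \<in> carrier (H (Suc n))"
    and differential_value: "gs \<in> tuples (carrier G) (Suc n) \<Longrightarrow> \<delta> n f (group_tensor k G gs) =
       (basis_elem k (hd gs) \<otimes>\<^bsub>K\<^esub> f (group_tensor k G (tl gs)))
       \<oplus>\<^bsub>K\<^esub> (\<Oplus>\<^bsub>K\<^esub>i\<in>{1..n}. sign i \<odot>\<^bsub>K\<^esub> f (group_tensor k G (merge_at G i gs)))
       \<oplus>\<^bsub>K\<^esub> (sign (n + 1) \<odot>\<^bsub>K\<^esub> (f (group_tensor k G (butlast gs)) \<otimes>\<^bsub>K\<^esub> basis_elem k (last gs)))"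
proof -
  interpret K: module k K by (rule module_K)
  let ?v = "\<lambda>gs. (basis_elem k (hd gs) \<otimes>\<^bsub>K\<^esub> f (group_tensor k G (tl gs)))
       \<oplus>\<^bsub>K\<^esub> (\<Oplus>\<^bsub>K\<^esub>i\<in>{1..n}. sign i \<odot>\<^bsub>K\<^esub> f (group_tensor k G (merge_at G i gs)))
       \<oplus>\<^bsub>K\<^esub> (sign (n + 1) \<odot>\<^bsub>K\<^esub> (f (group_tensor k G (butlast gs)) \<otimes>\<^bsub>K\<^esub> basis_elem k (last gs)))"
  have v: "?v \<in> tuples (carrier G) (Suc n) \<rightarrow> carrier K"
    by (intro Pi_I K.a_closed K.finsum_closed K.smult_closed differential_values_closed[OF f] sign_closed)
  have d: "\<delta> n f = cochain_with_values k G (Suc n) ?v"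
    by (simp only: hochschild_differential_def Let_def)
  show "\<delta> n f \<in> carrier (H (Suc n))"
    unfolding d by (rule cochain_with_values_closed[OF v])
  show "\<delta> n f (group_tensor k G gs) = ?v gs" if "gs \<in> tuples (carrier G) (Suc n)"
    unfolding d by (rule cochain_with_values_value[OF v that])
qed

text \<open>
  In cyclic coordinates the three kinds of terms of the differential become the faces of a single
  cyclic tuple: translating a coefficient by \<open>g\<^sub>1\<close> or \<open>g\<^sub>n\<^sub>+\<^sub>1\<close> merges that entry with
  the added entry \<open>h\<^sup>-\<^sup>1\<close>.
\<close>

lemma cyclic_coeff_differential:
  assumes f: "f \<in> carrier (H n)" and c: "c \<in> tuples (carrier G) (Suc (Suc n))"
  shows "cyclic_coeff (\<delta> n f) c = (\<Oplus>\<^bsub>k\<^esub>i\<in>{..Suc n}. sign i \<otimes>\<^bsub>k\<^esub> cyclic_coeff f (cyclic_face G i c))"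
proof -
  interpret K: module k K by (rule module_K)
  obtain a gs where cgs: "c = a # gs" "a \<in> carrier G" "gs \<in> tuples (carrier G) (Suc n)"
    using c by (cases c) (auto simp: tuples_def)
  obtain b cs where gs: "gs = b # cs" "b \<in> carrier G" "cs \<in> tuples (carrier G) n"
    using cgs(3) by (cases gs) (auto simp: tuples_def)
  have ends: "last gs \<in> carrier G" "butlast gs \<in> tuples (carrier G) n"
    using cgs(3) gs by (auto simp: tuples_def dest: in_set_butlastD)
  have len: "length gs = Suc n" using cgs(3) by (simp add: tuples_def)
  let ?t = "\<lambda>i. sign i \<otimes>\<^bsub>k\<^esub> cyclic_coeff f (cyclic_face G i c)"
  let ?F = "\<lambda>i. sign i \<odot>\<^bsub>K\<^esub> f (group_tensor k G (merge_at G i gs))"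
  note val = cochain_value_closed[OF f]
  note closed = differential_values_closed[OF f cgs(3)]
  have t: "?t i \<in> carrier k" for i
    by (intro k.m_closed sign_closed cyclic_coeff_closed[OF f] G.cyclic_face_tuples[OF c])
  have first: "(basis_elem k (hd gs) \<otimes>\<^bsub>K\<^esub> f (group_tensor k G (tl gs))) (inv\<^bsub>G\<^esub> a) = ?t 0"
  proof -
    have "cyclic_face G 0 c = (a \<otimes>\<^bsub>G\<^esub> b) # cs" by (simp add: cyclic_face_def cgs gs)
    then show ?thesis
      using cgs gs val[OF gs(3)]
      by (simp add: basis_mult_coeff cyclic_coeff_def G.inv_mult_group K_coeff_closed)
  qed
  have mid: "?F i (inv\<^bsub>G\<^esub> a) = ?t i" if i: "i \<in> {1..n}" for i
  proof -
    obtain i' where i': "i = Suc i'" using i by (cases i) auto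
    then have "cyclic_face G i c = a # merge_at G i gs"
      using i len by (simp add: cyclic_face_def cgs(1))
    then show ?thesis by (simp add: group_ring_simps(4) cyclic_coeff_def)
  qed
  have last: "(sign (n + 1) \<odot>\<^bsub>K\<^esub> (f (group_tensor k G (butlast gs)) \<otimes>\<^bsub>K\<^esub> basis_elem k (last gs))) (inv\<^bsub>G\<^esub> a)
      = ?t (Suc n)"
  proof -
    have "cyclic_face G (Suc n) c = (last gs \<otimes>\<^bsub>G\<^esub> a) # butlast gs"
      using len gs(1) by (simp add: cyclic_face_def cgs(1))
    then show ?thesis
      using ends cgs(2) val[OF ends(2)]
      by (simp add: group_ring_simps(4) mult_basis_coeff cyclic_coeff_def G.inv_mult_group)
  qed
  have "cyclic_coeff (\<delta> n f) c = \<delta> n f (group_tensor k G gs) (inv\<^bsub>G\<^esub> a)"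
    by (simp add: cyclic_coeff_def cgs(1))
  also have "\<dots> = ?t 0 \<oplus>\<^bsub>k\<^esub> (\<Oplus>\<^bsub>K\<^esub>i\<in>{1..n}. ?F i) (inv\<^bsub>G\<^esub> a) \<oplus>\<^bsub>k\<^esub> ?t (Suc n)"
    unfolding differential_value[OF f cgs(3)] group_ring_simps(3) first last ..
  also have "(\<Oplus>\<^bsub>K\<^esub>i\<in>{1..n}. ?F i) (inv\<^bsub>G\<^esub> a) = (\<Oplus>\<^bsub>k\<^esub>i\<in>{1..n}. ?F i (inv\<^bsub>G\<^esub> a))"
    by (rule finsum_K_coeff) (use closed(2) in blast)+
  also have "\<dots> = (\<Oplus>\<^bsub>k\<^esub>i\<in>{1..n}. ?t i)"
    using mid t by (intro k.finsum_cong') blast+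
  also have "?t 0 \<oplus>\<^bsub>k\<^esub> \<dots> = (\<Oplus>\<^bsub>k\<^esub>i\<in>insert 0 {1..n}. ?t i)"
    by (rule k.finsum_insert[symmetric]) (simp, simp, rule Pi_I, rule t, rule t)
  also have "insert 0 {1..n} = {..n}" by auto
  also have "(\<Oplus>\<^bsub>k\<^esub>i\<in>{..n}. ?t i) \<oplus>\<^bsub>k\<^esub> ?t (Suc n) = ?t (Suc n) \<oplus>\<^bsub>k\<^esub> (\<Oplus>\<^bsub>k\<^esub>i\<in>{..n}. ?t i)"
    by (intro k.a_comm k.finsum_closed Pi_I t)
  also have "\<dots> = (\<Oplus>\<^bsub>k\<^esub>i\<in>{..Suc n}. ?t i)"
    by (intro k.finsum_Suc[symmetric] Pi_I t)
  finally show ?thesis .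
qed

lemma differential_hom: "\<delta> n \<in> mod_hom k (H n) (H (Suc n))"
proof -
  interpret H: module k "H n" by (rule module_H)
  interpret H': module k "H (Suc n)" by (rule module_H)
  show ?thesis
  proof (rule mod_homI)
    fix f f' assume f: "f \<in> carrier (H n)" and f': "f' \<in> carrier (H n)"
    show "\<delta> n (f \<oplus>\<^bsub>H n\<^esub> f') = \<delta> n f \<oplus>\<^bsub>H (Suc n)\<^esub> \<delta> n f'"
    proof (rule cochain_eqI)
      fix c assume c: "c \<in> tuples (carrier G) (Suc (Suc n))"
      note face = G.cyclic_face_tuples[OF c]
      note closed = cyclic_coeff_closed[OF f face] cyclic_coeff_closed[OF f' face]
      have "cyclic_coeff (\<delta> n (f \<oplus>\<^bsub>H n\<^esub> f')) c
        = (\<Oplus>\<^bsub>k\<^esub>i\<in>{..Suc n}. sign i \<otimes>\<^bsub>k\<^esub> cyclic_coeff f (cyclic_face G i c)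
            \<oplus>\<^bsub>k\<^esub> sign i \<otimes>\<^bsub>k\<^esub> cyclic_coeff f' (cyclic_face G i c))"
        unfolding cyclic_coeff_differential[OF H.a_closed[OF f f'] c] cyclic_coeff_add[OF face]
        using closed by (intro k.finsum_cong') (auto simp: k.r_distr)
      also have "\<dots> = cyclic_coeff (\<delta> n f) c \<oplus>\<^bsub>k\<^esub> cyclic_coeff (\<delta> n f') c"
        unfolding cyclic_coeff_differential[OF f c] cyclic_coeff_differential[OF f' c]
        using closed by (intro k.finsum_addf) auto
      finally show "cyclic_coeff (\<delta> n (f \<oplus>\<^bsub>H n\<^esub> f')) c
          = cyclic_coeff (\<delta> n f \<oplus>\<^bsub>H (Suc n)\<^esub> \<delta> n f') c"
        by (simp add: cyclic_coeff_add[OF c])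
    qed (use f f' in \<open>auto intro: differential_closed\<close>)
  next
    fix r f assume r: "r \<in> carrier k" and f: "f \<in> carrier (H n)"
    show "\<delta> n (r \<odot>\<^bsub>H n\<^esub> f) = r \<odot>\<^bsub>H (Suc n)\<^esub> \<delta> n f"
    proof (rule cochain_eqI)
      fix c assume c: "c \<in> tuples (carrier G) (Suc (Suc n))"
      note face = G.cyclic_face_tuples[OF c]
      note closed = cyclic_coeff_closed[OF f face]
      have "cyclic_coeff (\<delta> n (r \<odot>\<^bsub>H n\<^esub> f)) c
        = (\<Oplus>\<^bsub>k\<^esub>i\<in>{..Suc n}. r \<otimes>\<^bsub>k\<^esub> (sign i \<otimes>\<^bsub>k\<^esub> cyclic_coeff f (cyclic_face G i c)))"
        unfolding cyclic_coeff_differential[OF H.smult_closed[OF r f] c] cyclic_coeff_smult[OF face]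
        using closed r by (intro k.finsum_cong') (auto simp: k.m_lcomm)
      also have "\<dots> = r \<otimes>\<^bsub>k\<^esub> cyclic_coeff (\<delta> n f) c"
        unfolding cyclic_coeff_differential[OF f c]
        using closed r by (intro k.finsum_rdistr[symmetric]) auto
      finally show "cyclic_coeff (\<delta> n (r \<odot>\<^bsub>H n\<^esub> f)) c = cyclic_coeff (r \<odot>\<^bsub>H (Suc n)\<^esub> \<delta> n f) c"
        by (simp add: cyclic_coeff_smult[OF c])
    qed (use r f in \<open>auto intro: differential_closed\<close>)
  qed (rule differential_closed)
qed

lemma differential_differential:
  assumes f: "f \<in> carrier (H n)"
  shows "\<delta> (Suc n) (\<delta> n f) = \<zero>\<^bsub>H (Suc (Suc n))\<^esub>"
proof -
  interpret H'': module k "H (Suc (Suc n))" by (rule module_H)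
  note df = differential_closed[OF f]
  show ?thesis
  proof (rule cochain_eqI)
    fix c assume c: "c \<in> tuples (carrier G) (Suc (Suc (Suc n)))"
    define t where "t j i = sign j \<otimes>\<^bsub>k\<^esub> (sign i \<otimes>\<^bsub>k\<^esub>
      cyclic_coeff f (cyclic_face G i (cyclic_face G j c)))" for j i
    have face: "cyclic_face G i (cyclic_face G j c) \<in> tuples (carrier G) (Suc n)" for i j
      by (intro G.cyclic_face_tuples c)
    note closed = cyclic_coeff_closed[OF f face]
    have t: "t j i \<in> carrier k" for j i unfolding t_def using closed by simp
    have cancel: "t j i = \<ominus>\<^bsub>k\<^esub> t i (j - 1)" if ij: "i < j" "j \<le> Suc (Suc n)" for i j
    proof -
      obtain j' where j: "j = Suc j'" using ij by (cases j) auto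
      have "cyclic_face G i (cyclic_face G j c) = cyclic_face G j' (cyclic_face G i c)"
        using G.cyclic_face_cyclic_face[of c i j] c ij j by (simp add: tuples_def)
      moreover have "(\<ominus>\<^bsub>k\<^esub> a) \<otimes>\<^bsub>k\<^esub> (b \<otimes>\<^bsub>k\<^esub> x) = \<ominus>\<^bsub>k\<^esub> (b \<otimes>\<^bsub>k\<^esub> (a \<otimes>\<^bsub>k\<^esub> x))"
        if "a \<in> carrier k" "b \<in> carrier k" "x \<in> carrier k" for a b x
        using that by (simp add: k.l_minus k.r_minus k.m_lcomm)
      ultimately show ?thesis
        unfolding t_def j sign_Suc diff_Suc_1 by (metis closed sign_closed)
    qed
    have "cyclic_coeff (\<delta> (Suc n) (\<delta> n f)) c
        = (\<Oplus>\<^bsub>k\<^esub>j\<in>{..Suc (Suc n)}. sign j \<otimes>\<^bsub>k\<^esub> (\<Oplus>\<^bsub>k\<^esub>i\<in>{..Suc n}.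
            sign i \<otimes>\<^bsub>k\<^esub> cyclic_coeff f (cyclic_face G i (cyclic_face G j c))))"
      unfolding cyclic_coeff_differential[OF df c]
        cyclic_coeff_differential[OF f G.cyclic_face_tuples[OF c]] ..
    also have "\<dots> = (\<Oplus>\<^bsub>k\<^esub>j\<in>{..Suc (Suc n)}. \<Oplus>\<^bsub>k\<^esub>i\<in>{..Suc n}. t j i)"
      using closed t
      by (intro k.finsum_cong' k.finsum_rdistr[THEN trans])
        (auto simp: t_def intro!: k.finsum_closed)
    also have "\<dots> = \<zero>\<^bsub>k\<^esub>"
      by (rule k.finsum_simplicial_cancel[of t "Suc n", OF t cancel])
    finally show "cyclic_coeff (\<delta> (Suc n) (\<delta> n f)) c = cyclic_coeff \<zero>\<^bsub>H (Suc (Suc n))\<^esub> c"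
      by (simp add: cyclic_coeff_zero[OF c])
  qed (auto intro: differential_closed df)
qed


section \<open>The splitting\<close>

text \<open>
  The cochains whose cyclic coordinates are supported on the tuples with trivial product
  (\<open>b = True\<close>), respectively on those with nontrivial product (\<open>b = False\<close>).
\<close>

definition supported_cochains :: "bool \<Rightarrow> nat \<Rightarrow> ('r, 'g) hochschild_cochain set" where
  "supported_cochains b n = {f \<in> carrier (H n). \<forall>c\<in>tuples (carrier G) (Suc n).
     (group_prod G c = \<one>\<^bsub>G\<^esub>) \<noteq> b \<longrightarrow> cyclic_coeff f c = \<zero>\<^bsub>k\<^esub>}"

lemma group_prod_inv_Cons:
  assumes "h \<in> carrier G" "gs \<in> tuples (carrier G) n"
  shows "group_prod G (inv\<^bsub>G\<^esub> h # gs) = \<one>\<^bsub>G\<^esub> \<longleftrightarrow> h = group_prod G gs"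
proof -
  have P: "group_prod G gs \<in> carrier G"
    using assms(2) by (intro G.group_prod_closed) (simp add: tuples_def)
  have "inv\<^bsub>G\<^esub> h \<otimes>\<^bsub>G\<^esub> group_prod G gs = \<one>\<^bsub>G\<^esub> \<longleftrightarrow> h = group_prod G gs"
    using assms(1) P by (metis G.inv_closed G.inv_equality G.inv_inv G.l_inv)
  then show ?thesis by simp
qed

lemma supported_cochains_values:
  assumes f: "f \<in> carrier (H n)"
  shows "f \<in> supported_cochains b n \<longleftrightarrow> (\<forall>gs\<in>tuples (carrier G) n. \<forall>h\<in>carrier G.
    (h = group_prod G gs) \<noteq> b \<longrightarrow> f (group_tensor k G gs) h = \<zero>\<^bsub>k\<^esub>)" (is "?l \<longleftrightarrow> ?r")
proof
  assume ?l
  then show ?r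
    by (auto simp: supported_cochains_def value_eq_cyclic_coeff group_prod_inv_Cons Cons_tuples
        simp del: group_prod_Cons)
next
  assume r: ?r
  have "cyclic_coeff f c = \<zero>\<^bsub>k\<^esub>"
    if c: "c \<in> tuples (carrier G) (Suc n)" and ne: "(group_prod G c = \<one>\<^bsub>G\<^esub>) \<noteq> b" for c
  proof -
    obtain a gs where a: "c = a # gs" "a \<in> carrier G" "gs \<in> tuples (carrier G) n"
      using c by (cases c) (auto simp: tuples_def)
    have "(inv\<^bsub>G\<^esub> a = group_prod G gs) \<noteq> b"
      using ne group_prod_inv_Cons[of "inv\<^bsub>G\<^esub> a" gs n] a by simp
    then show ?thesis using r a by (simp add: cyclic_coeff_def)
  qed
  then show ?l using f by (simp add: supported_cochains_def)
qed

lemma autopoietic_supported: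
  "{f \<in> carrier (H n). autopoietic k G n f} = supported_cochains True n"
proof -
  have "autopoietic k G n f \<longleftrightarrow> f \<in> supported_cochains True n" if f: "f \<in> carrier (H n)" for f
  proof -
    have "(\<exists>l\<in>carrier k. f (group_tensor k G gs) = l \<odot>\<^bsub>K\<^esub> basis_elem k (group_prod G gs))
        \<longleftrightarrow> (\<forall>h\<in>carrier G. h \<noteq> group_prod G gs \<longrightarrow> f (group_tensor k G gs) h = \<zero>\<^bsub>k\<^esub>)"
      (is "?l \<longleftrightarrow> ?r") if gs: "gs \<in> tuples (carrier G) n" for gs
    proof
      assume ?l
      then show ?r by (auto simp: group_ring_simps(4) basis_elem_def)
    next
      assume r: ?r
      note v = cochain_value_closed[OF f gs]
      have "f (group_tensor k G gs) = f (group_tensor k G gs) (group_prod G gs)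
          \<odot>\<^bsub>K\<^esub> basis_elem k (group_prod G gs)"
      proof
        fix h
        have "f (group_tensor k G gs) h = \<zero>\<^bsub>k\<^esub>" if "h \<noteq> group_prod G gs"
          using r that K_coeff_outside[OF v] by (cases "h \<in> carrier G") auto
        then show "f (group_tensor k G gs) h = (f (group_tensor k G gs) (group_prod G gs)
            \<odot>\<^bsub>K\<^esub> basis_elem k (group_prod G gs)) h"
          using K_coeff_closed[OF v] by (auto simp: group_ring_simps(4) basis_elem_def)
      qed
      then show ?l using K_coeff_closed[OF v] by blast
    qed
    then show ?thesis by (simp add: autopoietic_def supported_cochains_values[OF f])
  qed
  then show ?thesis by (auto simp: supported_cochains_def)
qed

lemma non_autopoietic_supported:
  "{f \<in> carrier (H n). non_autopoietic k G n f} = supported_cochains False n"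
proof -
  have "group_prod G gs \<in> carrier G" if "gs \<in> tuples (carrier G) n" for gs
    using that by (intro G.group_prod_closed) (simp add: tuples_def)
  then have "non_autopoietic k G n f \<longleftrightarrow> f \<in> supported_cochains False n" if f: "f \<in> carrier (H n)" for f
    by (auto simp: non_autopoietic_def coeff_at_def supported_cochains_values[OF f])
  then show ?thesis by (auto simp: supported_cochains_def)
qed

lemma submodule_supported_cochains: "submodule (supported_cochains b n) k (H n)"
proof -
  interpret H: module k "H n" by (rule module_H)
  have add: "f \<oplus>\<^bsub>H n\<^esub> f' \<in> supported_cochains b n"
    if "f \<in> supported_cochains b n" "f' \<in> supported_cochains b n" for f f'
    using that by (simp add: supported_cochains_def cyclic_coeff_add)
  have smult: "r \<odot>\<^bsub>H n\<^esub> f \<in> supported_cochains b n"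
    if "r \<in> carrier k" "f \<in> supported_cochains b n" for r f
    using that by (simp add: supported_cochains_def cyclic_coeff_smult)
  show ?thesis
  proof (rule H.submoduleI)
    show "supported_cochains b n \<subseteq> carrier (H n)" by (auto simp: supported_cochains_def)
    show "\<zero>\<^bsub>H n\<^esub> \<in> supported_cochains b n"
      by (simp add: supported_cochains_def cyclic_coeff_zero)
  next
    fix f assume f: "f \<in> supported_cochains b n"
    then have "\<ominus>\<^bsub>H n\<^esub> f = (\<ominus>\<^bsub>k\<^esub> \<one>\<^bsub>k\<^esub>) \<odot>\<^bsub>H n\<^esub> f"
      by (simp add: supported_cochains_def H.smult_l_minus)
    then show "\<ominus>\<^bsub>H n\<^esub> f \<in> supported_cochains b n" using smult f by simp
  qed (fact add smult)+
qed

text \<open>The differential respects supports because cyclic faces respect triviality of the product.\<close>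

lemma differential_supported:
  assumes "f \<in> supported_cochains b n"
  shows "\<delta> n f \<in> supported_cochains b (Suc n)"
proof -
  have f: "f \<in> carrier (H n)" using assms by (simp add: supported_cochains_def)
  have "cyclic_coeff (\<delta> n f) c = \<zero>\<^bsub>k\<^esub>"
    if c: "c \<in> tuples (carrier G) (Suc (Suc n))" and ne: "(group_prod G c = \<one>\<^bsub>G\<^esub>) \<noteq> b" for c
  proof -
    have "cyclic_coeff f (cyclic_face G i c) = \<zero>\<^bsub>k\<^esub>" for i
      using assms G.cyclic_face_tuples[OF c] G.group_prod_cyclic_face[OF c, of i] ne
      by (simp add: supported_cochains_def)
    then show ?thesis by (simp add: cyclic_coeff_differential[OF f c])
  qed
  then show ?thesis using differential_closed[OF f] by (simp add: supported_cochains_def)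
qed

text \<open>The restriction of the cyclic coordinates to one of the two kinds of tuples is a cochain.\<close>

lemma supported_part_exists:
  assumes f: "f \<in> carrier (H n)"
  obtains p where "p \<in> supported_cochains b n"
    "\<And>c. c \<in> tuples (carrier G) (Suc n) \<Longrightarrow>
      cyclic_coeff p c = (if (group_prod G c = \<one>\<^bsub>G\<^esub>) = b then cyclic_coeff f c else \<zero>\<^bsub>k\<^esub>)"
proof -
  let ?\<phi> = "\<lambda>c. if (group_prod G c = \<one>\<^bsub>G\<^esub>) = b then cyclic_coeff f c else \<zero>\<^bsub>k\<^esub>"
  have "(\<lambda>h. if h \<in> carrier G then ?\<phi> (inv\<^bsub>G\<^esub> h # gs) else \<zero>\<^bsub>k\<^esub>) \<in> carrier K"
    if gs: "gs \<in> tuples (carrier G) n" for gs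
  proof -
    note v = cochain_value_closed[OF f gs]
    have "finite {h. f (group_tensor k G gs) h \<noteq> \<zero>\<^bsub>k\<^esub>}"
      using v by (simp add: group_ring_simps free_module_simps)
    then have "finite {h. (if h \<in> carrier G then ?\<phi> (inv\<^bsub>G\<^esub> h # gs) else \<zero>\<^bsub>k\<^esub>) \<noteq> \<zero>\<^bsub>k\<^esub>}"
      by (rule rev_finite_subset) (auto simp: value_eq_cyclic_coeff split: if_splits)
    then show ?thesis
      using K_coeff_closed[OF v]
      by (auto simp: group_ring_simps free_module_simps value_eq_cyclic_coeff[symmetric])
  qed
  then obtain p where "p \<in> carrier (H n)"
    "\<And>c. c \<in> tuples (carrier G) (Suc n) \<Longrightarrow> cyclic_coeff p c = ?\<phi> c"
    by (rule cochain_of_cyclic_coeff_exists) blast+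
  then show ?thesis using that by (simp add: supported_cochains_def)
qed

lemma bij_betw_supported_sum:
  "bij_betw (\<lambda>(p, q). p \<oplus>\<^bsub>H n\<^esub> q) (supported_cochains True n \<times> supported_cochains False n) (carrier (H n))"
proof -
  interpret H: module k "H n" by (rule module_H)
  have sub: "f \<in> carrier (H n)" if "f \<in> supported_cochains b n" for f b
    using that by (simp add: supported_cochains_def)
  have coeff: "cyclic_coeff (p \<oplus>\<^bsub>H n\<^esub> q) c
      = (if group_prod G c = \<one>\<^bsub>G\<^esub> then cyclic_coeff p c else cyclic_coeff q c)"
    if "p \<in> supported_cochains True n" "q \<in> supported_cochains False n"
      "c \<in> tuples (carrier G) (Suc n)" for p q c
    using that cyclic_coeff_closed[OF sub[OF that(1)] that(3)]
      cyclic_coeff_closed[OF sub[OF that(2)] that(3)]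
    by (simp add: cyclic_coeff_add supported_cochains_def)
  show ?thesis unfolding bij_betw_def
  proof
    show "inj_on (\<lambda>(p, q). p \<oplus>\<^bsub>H n\<^esub> q) (supported_cochains True n \<times> supported_cochains False n)"
    proof (rule inj_onI, clarify)
      fix p q p' q'
      assume pq: "p \<in> supported_cochains True n" "q \<in> supported_cochains False n"
        and pq': "p' \<in> supported_cochains True n" "q' \<in> supported_cochains False n"
        and eq: "p \<oplus>\<^bsub>H n\<^esub> q = p' \<oplus>\<^bsub>H n\<^esub> q'"
      have e: "(if group_prod G c = \<one>\<^bsub>G\<^esub> then cyclic_coeff p c else cyclic_coeff q c)
          = (if group_prod G c = \<one>\<^bsub>G\<^esub> then cyclic_coeff p' c else cyclic_coeff q' c)"
        if "c \<in> tuples (carrier G) (Suc n)" for c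
        using coeff[OF pq that] coeff[OF pq' that] eq by simp
      have "cyclic_coeff p c = cyclic_coeff p' c" "cyclic_coeff q c = cyclic_coeff q' c"
        if "c \<in> tuples (carrier G) (Suc n)" for c
        using e[OF that] that pq pq' by (auto simp: supported_cochains_def split: if_splits)
      then show "p = p' \<and> q = q'"
        using cochain_eqI pq pq' sub by metis
    qed
    show "(\<lambda>(p, q). p \<oplus>\<^bsub>H n\<^esub> q) ` (supported_cochains True n \<times> supported_cochains False n)
        = carrier (H n)"
    proof
      show "(\<lambda>(p, q). p \<oplus>\<^bsub>H n\<^esub> q) ` (supported_cochains True n \<times> supported_cochains False n)
          \<subseteq> carrier (H n)"
        using sub by auto
      show "carrier (H n)
          \<subseteq> (\<lambda>(p, q). p \<oplus>\<^bsub>H n\<^esub> q) ` (supported_cochains True n \<times> supported_cochains False n)"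
      proof
        fix f assume f: "f \<in> carrier (H n)"
        obtain p where p: "p \<in> supported_cochains True n"
            "\<And>c. c \<in> tuples (carrier G) (Suc n) \<Longrightarrow>
              cyclic_coeff p c = (if (group_prod G c = \<one>\<^bsub>G\<^esub>) = True then cyclic_coeff f c else \<zero>\<^bsub>k\<^esub>)"
          using supported_part_exists[OF f] by blast
        obtain q where q: "q \<in> supported_cochains False n"
            "\<And>c. c \<in> tuples (carrier G) (Suc n) \<Longrightarrow>
              cyclic_coeff q c = (if (group_prod G c = \<one>\<^bsub>G\<^esub>) = False then cyclic_coeff f c else \<zero>\<^bsub>k\<^esub>)"
          using supported_part_exists[OF f] by blast
        have "f = p \<oplus>\<^bsub>H n\<^esub> q"
          using f p q sub coeff[OF p(1) q(1)] by (intro cochain_eqI) auto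
        then show "f \<in> (\<lambda>(p, q). p \<oplus>\<^bsub>H n\<^esub> q) ` (supported_cochains True n \<times> supported_cochains False n)"
          using p(1) q(1) by force
      qed
    qed
  qed
qed

lemma hochschild_is_cochain_complex: "is_cochain_complex k (hochschild_complex k G)"
  by (simp add: is_cochain_complex_def hochschild_complex_def module_H differential_hom
      differential_differential)

lemma supported_is_cochain_complex:
  "is_cochain_complex k \<lparr>cochains = (\<lambda>n. (H n)\<lparr>carrier := supported_cochains b n\<rparr>), differential = \<delta>\<rparr>"
proof -
  have sub: "f \<in> carrier (H n)" if "f \<in> supported_cochains b n" for f n
    using that by (simp add: supported_cochains_def)
  have "\<delta> n \<in> mod_hom k ((H n)\<lparr>carrier := supported_cochains b n\<rparr>)
      ((H (Suc n))\<lparr>carrier := supported_cochains b (Suc n)\<rparr>)" for n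
    using mod_homD[OF differential_hom] sub differential_supported
    by (intro mod_homI) auto
  then show ?thesis
    using submodule.submodule_is_module[OF submodule_supported_cochains module_H]
      sub differential_differential
    by (auto simp: is_cochain_complex_def)
qed

lemma AP_complex_eq:
  "AP_complex k G = \<lparr>cochains = (\<lambda>n. (H n)\<lparr>carrier := supported_cochains True n\<rparr>), differential = \<delta>\<rparr>"
  by (simp add: AP_complex_def autopoietic_supported)

lemma NP_complex_eq:
  "NP_complex k G = \<lparr>cochains = (\<lambda>n. (H n)\<lparr>carrier := supported_cochains False n\<rparr>), differential = \<delta>\<rparr>"
  by (simp add: NP_complex_def non_autopoietic_supported)

lemma sum_is_cochain_iso:
  "is_cochain_iso k (direct_sum_complex (AP_complex k G) (NP_complex k G)) (hochschild_complex k G)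
    (\<lambda>n (a, b). a \<oplus>\<^bsub>H n\<^esub> b)"
proof -
  have sub: "f \<in> carrier (H n)" if "f \<in> supported_cochains b n" for f n b
    using that by (simp add: supported_cochains_def)
  let ?D = "\<lambda>n. direct_sum_module ((H n)\<lparr>carrier := supported_cochains True n\<rparr>)
    ((H n)\<lparr>carrier := supported_cochains False n\<rparr>)"
  have hom: "(\<lambda>(a, b). a \<oplus>\<^bsub>H n\<^esub> b) \<in> mod_hom k (?D n) (H n)" for n
  proof -
    interpret H: module k "H n" by (rule module_H)
    show ?thesis
      by (intro mod_homI)
        (auto simp: direct_sum_module_def H.smult_r_distr sub H.a_assoc H.a_lcomm)
  qed
  show ?thesis
    unfolding is_cochain_iso_def direct_sum_complex_def AP_complex_eq NP_complex_eq hochschild_complex_def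
    using hom bij_betw_supported_sum
    by (auto simp: direct_sum_module_def mod_hom_add[OF differential_hom] sub)
qed

end

theorem lemma2p6:
  fixes k :: "'r ring" and G :: "'g monoid"
  assumes "cring k" and "group G"
  shows "is_cochain_complex k (hochschild_complex k G)
    \<and> is_cochain_complex k (AP_complex k G)
    \<and> is_cochain_complex k (NP_complex k G)
    \<and> is_cochain_iso k (direct_sum_complex (AP_complex k G) (NP_complex k G)) (hochschild_complex k G)
        (\<lambda>n (a, b). a \<oplus>\<^bsub>cochains (hochschild_complex k G) n\<^esub> b)"
proof -
  interpret cring k by fact
  interpret group G by fact
  interpret group_ring_data k G ..
  have "cochains (hochschild_complex k G) = H" by (simp add: hochschild_complex_def)
  then show ?thesis
    using hochschild_is_cochain_complex supported_is_cochain_complex sum_is_cochain_iso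
    by (simp add: AP_complex_eq NP_complex_eq)
qed

end
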